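(* Let $2\leq p<\infty$. Then there is a constant $c_p>0$ depending only on $p$ such that the following holds. If $f\in L^1(\mathrm{SU}(2))$ satisfies $$\sum_{l\in\frac12\mathbb{N}_0}(2l+1)^{\frac52p-4}\,\|\widehat{f}(l)\|^p_{\mathrm{HS}}<\infty,$$ then $f\in L^p(\mathrm{SU}(2))$ and $$\|f\|^p_{L^p(\mathrm{SU}(2))}\leq c_p\sum_{l\in\frac12\mathbb{N}_0}(2l+1)^{\frac52p-4}\,\|\widehat{f}(l)\|^p_{\mathrm{HS}}.$$
   Context: $\mathrm{SU}(2)$ carries the normalized Haar measure $du$, and $\frac12\mathbb{N}_0=\{0,\frac12,1,\frac32,\dots\}$. For $l\in\frac12\mathbb{N}_0$, let $V_l$ be the $(2l+1)$-dimensional space of homogeneous polynomials of degree $2l$ in two complex variables $z=(z_1,z_2)$ (a row vector), and let $t^l$ be the irreducible representation $(t^l(u)P)(z)=P(zu)$ of $\mathrm{SU}(2)$ on $V_l$, written in a basis of $V_l$ making it a unitary matrix representation $t^l:\mathrm{SU}(2)\to \mathrm{U}(2l+1)$. Every irreducible unitary representation of $\mathrm{SU}(2)$ is equivalent to exactly one $t^l$. The Fourier coefficient of $f\in L^1(\mathrm{SU}(2))$ is the matrix $\widehat f(l)=\int_{\mathrm{SU}(2)}f(u)\,t^l(u)^*\,du\in\mathbb{C}^{(2l+1)\times(2l+1)}$. $\|M\|_{\mathrm{HS}}=(\operatorname{Tr}MM^* )^{1/2}$ is the Hilbert–Schmidt norm. *)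

theory Defs
  imports "HOL-Probability.Probability" "Jordan_Normal_Form.Schur_Decomposition"
begin

(* Both libraries define "$", "mat" and "det".  Here "$" is the component of an HOL-Analysis
   vector; "mat" and "det" are qualified wherever they occur.  Elements of SU(2) are
   HOL-Analysis matrices (which carry a topology); the representation matrices, whose size
   varies with l, are Jordan_Normal_Form matrices. *)
no_notation vec_index (infixl "$" 100)

definition conj_transpose :: "complex^2^2 \<Rightarrow> complex^2^2" where
  "conj_transpose u = (\<chi> i j. cnj (u $ j $ i))"

definition SU2 :: "(complex^2^2) set" where
  "SU2 = {u. u ** conj_transpose u = Finite_Cartesian_Product.mat 1 \<and> Determinants.det u = 1}"

(* The measure has space SU2: the sigma-algebra determines it. *)
definition normalized_haar_SU2 :: "(complex^2^2) measure \<Rightarrow> bool" where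
  "normalized_haar_SU2 \<mu> \<longleftrightarrow>
     sets \<mu> = sets (restrict_space borel SU2) \<and> prob_space \<mu> \<and>
     (\<forall>v\<in>SU2. distr \<mu> \<mu> (\<lambda>u. v ** u) = \<mu>)"

(* Throughout, the half-integer l is encoded by the natural number n = 2l,
   so that dim V_l = 2l + 1 = n + 1. *)

definition hom_polys :: "nat \<Rightarrow> (complex^2 \<Rightarrow> complex) set" where
  "hom_polys n = {P. \<exists>a :: nat \<Rightarrow> complex. \<forall>z. P z = (\<Sum>k\<le>n. a k * (z $ 1) ^ k * (z $ 2) ^ (n - k))}"

definition is_basis_hom_polys :: "nat \<Rightarrow> (nat \<Rightarrow> complex^2 \<Rightarrow> complex) \<Rightarrow> bool" where
  "is_basis_hom_polys n b \<longleftrightarrow>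
     (\<forall>i<n+1. b i \<in> hom_polys n) \<and>
     (\<forall>P\<in>hom_polys n. \<exists>!a. a \<in> carrier_vec (n+1) \<and> (\<forall>z. P z = (\<Sum>i<n+1. vec_index a i * b i z)))"

(* z v* u is the product of the row vector z with the matrix u *)
definition SU2_act :: "complex^2^2 \<Rightarrow> (complex^2 \<Rightarrow> complex) \<Rightarrow> (complex^2 \<Rightarrow> complex)" where
  "SU2_act u P = (\<lambda>z. P (z v* u))"

definition unitary_mat :: "nat \<Rightarrow> complex mat \<Rightarrow> bool" where
  "unitary_mat m A \<longleftrightarrow> A \<in> carrier_mat m m \<and> A * mat_adjoint A = 1\<^sub>m m"

(* t is the matrix form of the representation of SU(2) on V_l in some basis for which all the
   matrices are unitary; column j of t u holds the coordinates of the image of b j. *)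
definition unitary_rep_SU2 :: "nat \<Rightarrow> (complex^2^2 \<Rightarrow> complex mat) \<Rightarrow> bool" where
  "unitary_rep_SU2 n t \<longleftrightarrow>
     (\<exists>b. is_basis_hom_polys n b \<and>
        (\<forall>u\<in>SU2. unitary_mat (n+1) (t u) \<and>
           (\<forall>j<n+1. \<forall>z. SU2_act u (b j) z = (\<Sum>i<n+1. t u $$ (i, j) * b i z))))"

definition fourier_coeff ::
  "(complex^2^2) measure \<Rightarrow> (nat \<Rightarrow> complex^2^2 \<Rightarrow> complex mat) \<Rightarrow> (complex^2^2 \<Rightarrow> complex) \<Rightarrow> nat \<Rightarrow> complex mat"
  where
  "fourier_coeff \<mu> t f n =
     Matrix.mat (n+1) (n+1) (\<lambda>(i, j). LINT u|\<mu>. f u * mat_adjoint (t n u) $$ (i, j))"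

definition mat_trace :: "complex mat \<Rightarrow> complex" where
  "mat_trace A = (\<Sum>i<dim_row A. A $$ (i, i))"

definition hs_norm :: "complex mat \<Rightarrow> real" where
  "hs_norm A = sqrt (Re (mat_trace (A * mat_adjoint A)))"

definition Lp_space :: "'a measure \<Rightarrow> real \<Rightarrow> ('a \<Rightarrow> complex) set" where
  "Lp_space M p = {f \<in> borel_measurable M. integrable M (\<lambda>x. norm (f x) powr p)}"

definition Lp_norm :: "'a measure \<Rightarrow> real \<Rightarrow> ('a \<Rightarrow> complex) \<Rightarrow> real" where
  "Lp_norm M p f = (LINT x|M. norm (f x) powr p) powr (1 / p)"

end

theory Submission
  imports Defs
begin

text \<open>
  Write \<open>d = n + 1\<close>, let \<open>F\<^sub>n = d Tr(f\<^bsub>n\<^esub> t\<^sub>n)\<close> be the \<open>n\<close>-th block of the Fourier series of \<open>f\<close>, with \<open>f\<^bsub>n\<^esub>\<close> the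
  \<open>n\<close>-th coefficient, and put \<open>b\<^sub>n = d\<^bsup>3/2\<^esup> \<parallel>f\<^bsub>n\<^esub>\<parallel>\<close>. Then \<open>\<bar>F\<^sub>n\<bar> \<le> b\<^sub>n\<close>, and by Schur orthogonality the
  blocks are orthogonal with \<open>L\<^sup>2\<close> norm \<open>b\<^sub>n / d\<close>; the right-hand side of the theorem is
  \<open>\<Sum> d\<^bsup>p-4\<^esup> b\<^sub>n\<^sup>p\<close>. At a point where \<open>\<bar>f\<bar>\<close> exceeds twice \<open>b\<^sub>0 + \<dots> + b\<^sub>N\<close>, at least half of its size comes from
  the blocks beyond \<open>N\<close>, which are controlled in \<open>L\<^sup>2\<close>. Summing over these level sets gives
  \<open>\<parallel>f\<parallel>\<^sub>p\<^sup>p \<le> C \<Sum> (b\<^sub>n / d)\<^sup>2 (b\<^sub>0 + \<dots> + b\<^sub>n)\<^bsup>p-2\<^esup>\<close>, and a weighted Hardy inequality finishes the estimate.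

  Schur orthogonality holds because an \<open>SU(2)\<close>-invariant kernel that is homogeneous of degree \<open>n\<close> in \<open>z\<close> and
  of degree \<open>m\<close> in the conjugate of \<open>w\<close> is a multiple of \<open>\<langle>z, w\<rangle>\<^sup>n\<close>, and vanishes for \<open>n \<noteq> m\<close>. That an integrable
  \<open>f\<close> equals the \<open>L\<^sup>2\<close> sum of its blocks follows from Stone-Weierstrass: matrix coefficients
  span an algebra containing the entries of \<open>u\<close>.
\<close>

section \<open>A weighted Hardy inequality\<close>

lemma powr_diff_le:
  fixes x y p :: real
  assumes "0 \<le> y" "y \<le> x" "1 \<le> p"
  shows "x powr p - y powr p \<le> p * (x - y) * x powr (p - 1)"
proof (cases "y = 0 \<or> x = y")
  case True
  then show ?thesis
  proof
    assume "y = 0"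
    show ?thesis
    proof (cases "x = 0")
      case False
      then have "x powr p = x * x powr (p - 1)"
        using assms by (simp add: powr_mult_base)
      moreover have "1 * (x * x powr (p - 1)) \<le> p * (x * x powr (p - 1))"
        using assms by (intro mult_right_mono) auto
      ultimately show ?thesis using \<open>y = 0\<close> by simp
    qed (use \<open>y = 0\<close> in simp)
  qed simp
next
  case False
  then have xy: "0 < y" "y < x" using assms by auto
  have "\<exists>z>y. z < x \<and> x powr p - y powr p = (x - y) * (p * z powr (p - 1))"
    using xy by (intro MVT2) (auto intro!: has_real_derivative_powr)
  then obtain z where z: "y < z" "z < x" "x powr p - y powr p = (x - y) * (p * z powr (p - 1))"
    by blast
  have "z powr (p - 1) \<le> x powr (p - 1)"
    using z xy assms by (intro powr_mono2) auto
  then show ?thesis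
    using z xy assms by (simp add: mult_left_mono mult.assoc mult.left_commute)
qed

text \<open>A crude Young inequality: replacing the smaller of \<open>x\<close> and \<open>y\<close>
  by the larger turns the product into a single power. It is applied with \<open>q = 1\<close> and
  \<open>q = 2\<close>.\<close>

lemma mult_powr_le_powr_add:
  fixes x y p q :: real
  assumes "0 \<le> x" "0 \<le> y" "0 \<le> q" "q \<le> p"
  shows "x powr q * y powr (p - q) \<le> x powr p + y powr p"
proof (cases "x \<le> y")
  case True
  have "x powr q * y powr (p - q) \<le> y powr q * y powr (p - q)"
    using True assms by (intro mult_right_mono powr_mono2) auto
  also have "\<dots> = y powr p" by (simp flip: powr_add)
  finally show ?thesis by (simp add: add_increasing)
next
  case False
  have "x powr q * y powr (p - q) \<le> x powr q * x powr (p - q)"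
    using False assms by (intro mult_left_mono powr_mono2) auto
  also have "\<dots> = x powr p" by (simp flip: powr_add)
  finally show ?thesis by (simp add: add_increasing2)
qed

text \<open>The right-hand side is a discrete derivative dominating the weight. With numerators
  \<open>1\<close> instead of \<open>2\<close> the bound would fail at \<open>n = 0\<close>, where
  the difference would be \<open>7 / 8\<close>.\<close>

lemma inverse_fourth_power_le:
  "1 / (real n + 1) ^ 4 \<le> 2 / (real n + 1) ^ 3 - 2 / (real n + 2) ^ 3"
proof -
  define d where "d = real n + 1"
  have d: "d \<ge> 1" by (simp add: d_def)
  have "2 / d ^ 3 - 2 / (d + 1) ^ 3 - 1 / d ^ 4
      = (2 * d * ((d + 1) ^ 3 - d ^ 3) - (d + 1) ^ 3) / (d ^ 4 * (d + 1) ^ 3)"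
  proof -
    have "2 / d ^ 3 - 2 / e ^ 3 - 1 / d ^ 4 = (2 * d * (e ^ 3 - d ^ 3) - e ^ 3) / (d ^ 4 * e ^ 3)"
      if "e > 0" for e
      using d that by (simp add: field_simps power_numeral_reduce)
    from this[of "d + 1"] show ?thesis using d by simp
  qed
  also have "2 * d * ((d + 1) ^ 3 - d ^ 3) - (d + 1) ^ 3 = 5 * d ^ 3 + 3 * d ^ 2 - d - 1"
    by (simp add: algebra_simps power_numeral_reduce)
  also have "0 \<le> (5 * d ^ 3 + 3 * d ^ 2 - d - 1) / (d ^ 4 * (d + 1) ^ 3)"
  proof (intro divide_nonneg_nonneg)
    have "d \<le> d ^ 3" "1 \<le> d ^ 3"
      using d self_le_power[of d 3] one_le_power[of d 3] by auto
    moreover have "0 \<le> d ^ 2" by simp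
    ultimately show "0 \<le> 5 * d ^ 3 + 3 * d ^ 2 - d - 1" by linarith
  qed (use d in auto)
  finally show ?thesis by (simp add: d_def add.assoc)
qed

text \<open>Summation by parts against the primitive \<open>2 / d\<^sup>3\<close> of the weight, followed by Young's
  inequality, absorbs half of the left-hand side.\<close>

lemma hardy_inequality_weighted:
  fixes b :: "nat \<Rightarrow> real" and p :: real
  assumes b: "\<And>n. 0 \<le> b n" and p: "1 \<le> p"
  defines "S \<equiv> \<lambda>n. \<Sum>k\<le>n. b k"
  shows "(\<Sum>n\<le>M. S n powr p / (real n + 1) ^ 4)
      \<le> (4 * p) powr p * (\<Sum>n\<le>M. (real n + 1) powr (p - 4) * b n powr p)"
proof -
  have S0: "0 \<le> S n" for n using b by (simp add: S_def sum_nonneg)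
  \<comment> \<open>\<open>R n\<close> is the partial sum preceding \<open>S n\<close>, with
    \<open>R 0 = 0\<close>; the shift avoids subtraction of natural numbers in the summation by
    parts.\<close>
  define R where "R n = (\<Sum>k<n. b k)" for n
  have R0: "0 \<le> R n" for n using b by (simp add: R_def sum_nonneg)
  have RS: "S n = R n + b n" "R (Suc n) = S n" for n
    by (simp_all add: R_def S_def lessThan_Suc_atMost flip: lessThan_Suc_atMost)
  have "R 0 = 0" by (simp add: R_def)
  define \<tau> where "\<tau> n = 2 / (real n + 1) ^ 3" for n
  have \<tau>0: "0 \<le> \<tau> n" for n by (simp add: \<tau>_def)
  have parts: "(\<Sum>n\<le>M. (\<tau> n - \<tau> (Suc n)) * S n powr p) + \<tau> (Suc M) * S M powr p
      = (\<Sum>n\<le>M. \<tau> n * (S n powr p - R n powr p))" for M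
    using \<open>R 0 = 0\<close> by (induction M) (auto simp: RS(2) algebra_simps)
  have young: "\<tau> n * (S n powr p - R n powr p)
      \<le> (4 * p) powr p / 2 * ((real n + 1) powr (p - 4) * b n powr p) + S n powr p / (real n + 1) ^ 4 / 2" for n
  proof -
    define d where "d = real n + 1"
    have d: "d > 0" by (simp add: d_def)
    have "\<tau> n = 2 / d ^ 3" by (simp add: \<tau>_def d_def)
    have "S n powr p - R n powr p \<le> p * (S n - R n) * S n powr (p - 1)"
      using R0 b p by (intro powr_diff_le) (auto simp: RS)
    then have "\<tau> n * (S n powr p - R n powr p) \<le> \<tau> n * (p * b n * S n powr (p - 1))"
      using \<tau>0 by (intro mult_left_mono) (auto simp: RS)
    \<comment> \<open>The factor \<open>4 * p * d\<close> is arranged so that Young's inequality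
      leaves \<open>S n powr p\<close> with exactly half of its weight
      \<open>1 / d ^ 4\<close>.\<close>
    also have "\<dots> = (1 / (2 * d ^ 4)) * ((4 * p * d * b n) * S n powr (p - 1))"
      using d unfolding \<open>\<tau> n = 2 / d ^ 3\<close> by (simp add: field_simps power_numeral_reduce)
    also have "\<dots> \<le> (1 / (2 * d ^ 4)) * ((4 * p * d * b n) powr p + S n powr p)"
      using mult_powr_le_powr_add[of "4 * p * d * b n" "S n" 1 p] p d b[of n] S0[of n]
      by (intro mult_left_mono) auto
    also have "(4 * p * d * b n) powr p = (4 * p) powr p * d powr p * b n powr p"
      using p d b[of n] by (simp add: powr_mult)
    also have "1 / (2 * d ^ 4) * ((4 * p) powr p * d powr p * b n powr p + S n powr p)
        = (4 * p) powr p / 2 * (d powr (p - 4) * b n powr p) + S n powr p / d ^ 4 / 2"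
      using d by (simp add: powr_diff field_simps)
    finally show ?thesis using d by (simp add: d_def)
  qed
  have "(\<Sum>n\<le>M. S n powr p / (real n + 1) ^ 4) \<le> (\<Sum>n\<le>M. (\<tau> n - \<tau> (Suc n)) * S n powr p)"
  proof (intro sum_mono)
    fix n
    have "1 / (real n + 1) ^ 4 \<le> \<tau> n - \<tau> (Suc n)"
      using inverse_fourth_power_le[of n] by (simp add: \<tau>_def add.commute)
    from mult_right_mono[OF this, of "S n powr p"]
    show "S n powr p / (real n + 1) ^ 4 \<le> (\<tau> n - \<tau> (Suc n)) * S n powr p" by simp
  qed
  \<comment> \<open>The boundary term of the summation by parts is nonnegative and is
    dropped.\<close>
  also have "\<dots> \<le> (\<Sum>n\<le>M. \<tau> n * (S n powr p - R n powr p))"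
    using \<tau>0[of "Suc M"] by (simp flip: parts)
  also have "\<dots> \<le> (\<Sum>n\<le>M. (4 * p) powr p / 2 * ((real n + 1) powr (p - 4) * b n powr p)
      + S n powr p / (real n + 1) ^ 4 / 2)"
    by (intro sum_mono young)
  also have "\<dots> = (4 * p) powr p / 2 * (\<Sum>n\<le>M. (real n + 1) powr (p - 4) * b n powr p)
      + (\<Sum>n\<le>M. S n powr p / (real n + 1) ^ 4) / 2"
    by (simp only: sum.distrib flip: sum_distrib_left sum_divide_distrib)
  \<comment> \<open>The left-hand side has reappeared on the right with factor \<open>1 / 2\<close>;
    being a finite sum, it can be subtracted.\<close>
  finally show ?thesis by simp
qed

text \<open>Marcinkiewicz-type bound: \<open>b n\<close> plays the role of the sup norm of the \<open>n\<close>-th block,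
  \<open>b n / (n + 1)\<close> that of its \<open>L\<^sup>2\<close> norm.\<close>

lemma weighted_square_sum_le:
  fixes b :: "nat \<Rightarrow> real" and p :: real
  assumes b: "\<And>n. 0 \<le> b n" and p: "2 \<le> p"
  shows "(\<Sum>n\<le>M. (b n / (real n + 1))\<^sup>2 * (\<Sum>k\<le>n. b k) powr (p - 2))
      \<le> (1 + (4 * p) powr p) * (\<Sum>n\<le>M. (real n + 1) powr (p - 4) * b n powr p)"
proof -
  define S where "S n = (\<Sum>k\<le>n. b k)" for n
  have "(b n / (real n + 1))\<^sup>2 * S n powr (p - 2)
      \<le> (real n + 1) powr (p - 4) * b n powr p + S n powr p / (real n + 1) ^ 4" for n
  proof -
    define d where "d = real n + 1"
    have d: "d > 0" by (simp add: d_def)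
    have S0: "0 \<le> S n" using b by (simp add: S_def sum_nonneg)
    \<comment> \<open>Grouping \<open>S n\<close> with \<open>1 / d\<close> makes Young's inequality
      produce exactly the target term and the Hardy term with weight
      \<open>1 / d ^ 4\<close>.\<close>
    have "(b n / d)\<^sup>2 * S n powr (p - 2) = d powr (p - 4) * ((b n) powr 2 * (S n / d) powr (p - 2))"
      using d b[of n] S0 by (simp add: powr_divide powr_diff field_simps power_numeral_reduce)
    also have "\<dots> \<le> d powr (p - 4) * (b n powr p + (S n / d) powr p)"
      using b[of n] S0 d p by (intro mult_left_mono mult_powr_le_powr_add) auto
    also have "\<dots> = d powr (p - 4) * b n powr p + S n powr p / d ^ 4"
      using d S0 by (simp add: powr_divide powr_diff field_simps)
    finally show ?thesis by (simp add: d_def)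
  qed
  then have "(\<Sum>n\<le>M. (b n / (real n + 1))\<^sup>2 * S n powr (p - 2))
      \<le> (\<Sum>n\<le>M. (real n + 1) powr (p - 4) * b n powr p + S n powr p / (real n + 1) ^ 4)"
    by (intro sum_mono)
  also have "\<dots> \<le> (1 + (4 * p) powr p) * (\<Sum>n\<le>M. (real n + 1) powr (p - 4) * b n powr p)"
    using hardy_inequality_weighted[of b p M] b p by (simp add: sum.distrib S_def algebra_simps)
  finally show ?thesis by (simp add: S_def)
qed

text \<open>The same use of Young's inequality, with the partial sum replaced by \<open>1\<close>,
  leaves the summable error \<open>1 / d ^ 4\<close>. This is how the hypothesis of the theorem
  yields mean-square convergence of the blocks.\<close>

lemma summable_square_of_weighted:
  fixes b :: "nat \<Rightarrow> real" and p :: real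
  assumes b: "\<And>n. 0 \<le> b n" and p: "2 \<le> p"
    and sm: "summable (\<lambda>n. (real n + 1) powr (p - 4) * b n powr p)"
  shows "summable (\<lambda>n. (b n / (real n + 1))\<^sup>2)"
proof (rule summable_comparison_test')
  have "summable (\<lambda>n. 1 / real (Suc n) ^ 4)"
    using inverse_power_summable[of 4, where 'a = real]
    by (subst summable_Suc_iff) (simp add: inverse_eq_divide)
  then show "summable (\<lambda>n. (real n + 1) powr (p - 4) * b n powr p + 1 / (real n + 1) ^ 4)"
    by (intro summable_add sm) (simp add: add.commute)
  fix n
  define d where "d = real n + 1"
  have d: "d > 0" by (simp add: d_def)
  have "(b n / d)\<^sup>2 = d powr (p - 4) * ((b n) powr 2 * (1 / d) powr (p - 2))"
    using d b[of n] by (simp add: powr_divide powr_diff field_simps power_numeral_reduce)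
  also have "\<dots> \<le> d powr (p - 4) * (b n powr p + (1 / d) powr p)"
    using b[of n] d p by (intro mult_left_mono mult_powr_le_powr_add) auto
  also have "\<dots> = d powr (p - 4) * b n powr p + 1 / d ^ 4"
    using d by (simp add: powr_divide powr_diff field_simps)
  finally show "norm ((b n / (real n + 1))\<^sup>2) \<le> (real n + 1) powr (p - 4) * b n powr p + 1 / (real n + 1) ^ 4"
    by (simp add: d_def)
qed

section \<open>Sums of bounded orthogonal functions\<close>

text \<open>Tonelli's theorem for counting measure.\<close>

lemma suminf_ennreal_commute:
  fixes f :: "nat \<Rightarrow> nat \<Rightarrow> ennreal"
  shows "(\<Sum>m. \<Sum>n. f m n) = (\<Sum>n. \<Sum>m. f m n)"
proof -
  have "(\<Sum>m. \<Sum>n. f m n) = (\<integral>\<^sup>+m. (\<Sum>n. f m n) \<partial>count_space UNIV)"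
    by (simp add: nn_integral_count_space_nat)
  also have "\<dots> = (\<Sum>n. \<integral>\<^sup>+m. f m n \<partial>count_space UNIV)"
    by (rule nn_integral_suminf) simp
  finally show ?thesis by (simp add: nn_integral_count_space_nat)
qed

lemma borel_measurable_cnj [measurable (raw)]:
  "f \<in> borel_measurable M \<Longrightarrow> (\<lambda>x. cnj (f x)) \<in> borel_measurable M"
  by (rule borel_measurable_continuous_on[where f = cnj]) (auto intro: continuous_intros)

lemma ennreal_suminf_if_le:
  fixes a :: "nat \<Rightarrow> ennreal"
  shows "(\<Sum>N. if N \<le> n then a N else 0) = (\<Sum>N\<le>n. a N)"
  by (subst suminf_finite[of "{..n}"]) (auto intro: sum.cong)

lemma (in finite_measure) integrable_norm_bounded:
  fixes f :: "'a \<Rightarrow> 'b::{banach, second_countable_topology}"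
  assumes "f \<in> borel_measurable M" "\<And>x. x \<in> space M \<Longrightarrow> norm (f x) \<le> B"
  shows "integrable M f"
  using assms by (intro integrable_const_bound[of _ B]) auto

lemma integrable_mult_bounded:
  fixes k h :: "'a \<Rightarrow> complex"
  assumes k: "integrable M k" and h: "h \<in> borel_measurable M" "\<And>x. x \<in> space M \<Longrightarrow> norm (h x) \<le> B"
  shows "integrable M (\<lambda>x. k x * h x)"
proof (rule Bochner_Integration.integrable_bound[where f = "\<lambda>x. B * norm (k x)"])
  show "AE x in M. norm (k x * h x) \<le> norm (B * norm (k x))"
  proof (rule AE_I2)
    fix x assume "x \<in> space M"
    then have "norm (h x) \<le> \<bar>B\<bar>" using h(2)[of x] by linarith
    then show "norm (k x * h x) \<le> norm (B * norm (k x))"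
      by (simp add: norm_mult abs_mult mult.commute[of "norm (k x)"] mult_right_mono)
  qed
qed (use k h in auto)

text \<open>With \<open>s K\<close> twice the sup bound for the partial sum \<open>L K\<close>, each \<open>N < K\<close> with
  \<open>s N < \<bar>z\<bar>\<close> has \<open>\<bar>z\<bar> \<le> 2 \<bar>z - L N\<bar>\<close>.\<close>

lemma norm_powr_le_layers:
  fixes z :: complex and L :: "nat \<Rightarrow> complex" and s :: "nat \<Rightarrow> real"
  assumes p: "2 \<le> p" and L: "\<And>N. 2 * norm (L N) \<le> s N" and "mono s" and "s 0 = 0"
    and z: "norm z \<le> s K"
  shows "\<exists>K. norm z powr p \<le> (\<Sum>N<K. 4 * (s (Suc N) powr (p - 2) - s N powr (p - 2)) * (norm (z - L N))\<^sup>2)"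
proof -
  \<comment> \<open>\<open>K0\<close> is the first level reaching \<open>norm z\<close>; all earlier
    levels lie below \<open>norm z\<close>, so every layer with \<open>N < K0\<close>
    contributes.\<close>
  define K0 where "K0 = (LEAST K. norm z \<le> s K)"
  have K0: "norm z \<le> s K0" unfolding K0_def by (rule LeastI[of _ K], rule z)
  have small: "s N < norm z" if "N < K0" for N
    using not_less_Least[of N "\<lambda>K. norm z \<le> s K"] that unfolding K0_def by auto
  have s0: "0 \<le> s N" for N using \<open>mono s\<close> \<open>s 0 = 0\<close> by (metis le0 monoD)
  have sm: "s N powr (p - 2) \<le> s (Suc N) powr (p - 2)" for N
    using \<open>mono s\<close> s0 p by (intro powr_mono2) (auto simp: mono_def)
  have "norm z powr p = (norm z)\<^sup>2 * norm z powr (p - 2)"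
    by (cases "z = 0") (auto simp: powr_diff)
  also have "\<dots> \<le> (norm z)\<^sup>2 * s K0 powr (p - 2)"
    using K0 p by (intro mult_left_mono powr_mono2) auto
  \<comment> \<open>The lower end of the telescoping sum is \<open>0 powr (p - 2)\<close>, which is
    \<open>0\<close> also for \<open>p = 2\<close>.\<close>
  also have "s K0 powr (p - 2) = (\<Sum>N<K0. s (Suc N) powr (p - 2) - s N powr (p - 2))"
    using \<open>s 0 = 0\<close> by (simp add: sum_lessThan_telescope[of "\<lambda>N. s N powr (p - 2)"])
  also have "(norm z)\<^sup>2 * \<dots> \<le> (\<Sum>N<K0. 4 * (s (Suc N) powr (p - 2) - s N powr (p - 2)) * (norm (z - L N))\<^sup>2)"
    unfolding sum_distrib_left
  proof (intro sum_mono)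
    fix N assume "N \<in> {..<K0}"
    then have "2 * norm (L N) \<le> norm z" using small[of N] L[of N] by auto
    then have "norm z \<le> 2 * norm (z - L N)"
      using norm_triangle_ineq2[of z "L N"] by auto
    then have "(norm z)\<^sup>2 \<le> (2 * norm (z - L N))\<^sup>2" by (intro power_mono) auto
    also have "\<dots> = 4 * (norm (z - L N))\<^sup>2" by (simp add: power_mult_distrib)
    finally have "(norm z)\<^sup>2 * (s (Suc N) powr (p - 2) - s N powr (p - 2))
        \<le> (4 * (norm (z - L N))\<^sup>2) * (s (Suc N) powr (p - 2) - s N powr (p - 2))"
      using sm by (intro mult_right_mono) auto
    then show "(norm z)\<^sup>2 * (s (Suc N) powr (p - 2) - s N powr (p - 2))
        \<le> 4 * (s (Suc N) powr (p - 2) - s N powr (p - 2)) * (norm (z - L N))\<^sup>2"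
      by (simp only: mult_ac)
  qed
  finally show ?thesis by blast
qed

text \<open>The properties of Fourier blocks on which the \<open>L^p\<close> estimate rests,
  isolated from the group.\<close>

locale orthogonal_blocks = prob_space M for M :: "'a measure" +
  fixes F :: "nat \<Rightarrow> 'a \<Rightarrow> complex" and b :: "nat \<Rightarrow> real"
  assumes F_measurable [measurable]: "\<And>n. F n \<in> borel_measurable M"
    and F_bound: "\<And>n x. x \<in> space M \<Longrightarrow> norm (F n x) \<le> b n"
    and F_orthogonal: "\<And>n m. n \<noteq> m \<Longrightarrow> (LINT x|M. F n x * cnj (F m x)) = 0"
    and F_square: "\<And>n. (LINT x|M. F n x * cnj (F n x)) = complex_of_real ((b n / (real n + 1))\<^sup>2)"
    and square_summable: "summable (\<lambda>n. (b n / (real n + 1))\<^sup>2)"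
begin

lemma b_nonneg: "0 \<le> b n"
proof -
  obtain x where "x \<in> space M" using not_empty by auto
  then show ?thesis using F_bound[of x n] norm_ge_zero[of "F n x"] by linarith
qed

section \<open>Partial sums and their tails in \<open>L^2\<close>\<close>

definition L :: "nat \<Rightarrow> 'a \<Rightarrow> complex" where
  "L N x = (\<Sum>n<N. F n x)"

definition q2 :: "nat \<Rightarrow> real" where
  "q2 n = (b n / (real n + 1))\<^sup>2"

lemma q2_nonneg [simp]: "0 \<le> q2 n"
  by (simp add: q2_def)

lemma L_measurable [measurable]: "L N \<in> borel_measurable M"
  unfolding L_def by measurable

lemma L_bound: "x \<in> space M \<Longrightarrow> norm (L N x) \<le> (\<Sum>n<N. b n)"
  unfolding L_def by (intro sum_norm_le) (auto intro: F_bound)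

lemma L_integrable: "integrable M (L N)"
  by (rule integrable_norm_bounded[where B = "\<Sum>n<N. b n"]) (auto intro: L_bound)

lemma integrable_F_mult: "integrable M (\<lambda>x. F n x * cnj (F m x))"
proof (rule integrable_norm_bounded[where B = "b n * b m"])
  show "norm (F n x * cnj (F m x)) \<le> b n * b m" if "x \<in> space M" for x
    using that b_nonneg by (simp add: norm_mult mult_mono F_bound)
qed measurable

lemma integral_square_sum:
  "integrable M (\<lambda>x. (norm (\<Sum>n\<in>I. F n x))\<^sup>2)"
  "finite I \<Longrightarrow> (LINT x|M. (norm (\<Sum>n\<in>I. F n x))\<^sup>2) = (\<Sum>n\<in>I. q2 n)"
proof -
  show "integrable M (\<lambda>x. (norm (\<Sum>n\<in>I. F n x))\<^sup>2)"
  proof (rule integrable_norm_bounded[where B = "(\<Sum>n\<in>I. b n)\<^sup>2"])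
    fix x assume "x \<in> space M"
    then have "norm (\<Sum>n\<in>I. F n x) \<le> (\<Sum>n\<in>I. b n)" by (intro sum_norm_le F_bound)
    then show "norm ((norm (\<Sum>n\<in>I. F n x))\<^sup>2) \<le> (\<Sum>n\<in>I. b n)\<^sup>2" by (simp add: power_mono)
  qed measurable
  assume "finite I"
  have "complex_of_real (LINT x|M. (norm (\<Sum>n\<in>I. F n x))\<^sup>2)
      = (LINT x|M. complex_of_real ((norm (\<Sum>n\<in>I. F n x))\<^sup>2))"
    by (rule integral_complex_of_real[symmetric])
  also have "\<dots> = (LINT x|M. (\<Sum>n\<in>I. \<Sum>m\<in>I. F n x * cnj (F m x)))"
    by (simp add: complex_norm_square cnj_sum sum_product del: of_real_power)
  also have "\<dots> = (\<Sum>n\<in>I. \<Sum>m\<in>I. LINT x|M. F n x * cnj (F m x))"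
    by (subst Bochner_Integration.integral_sum; (intro Bochner_Integration.integrable_sum integrable_F_mult)?)
       (intro sum.cong refl Bochner_Integration.integral_sum integrable_F_mult)
  also have "\<dots> = (\<Sum>n\<in>I. \<Sum>m\<in>I. if m = n then complex_of_real (q2 n) else 0)"
    by (intro sum.cong refl) (auto simp: F_orthogonal F_square q2_def)
  also have "\<dots> = complex_of_real (\<Sum>n\<in>I. q2 n)"
    using \<open>finite I\<close> by simp
  finally show "(LINT x|M. (norm (\<Sum>n\<in>I. F n x))\<^sup>2) = (\<Sum>n\<in>I. q2 n)"
    by (simp only: of_real_eq_iff)
qed

text \<open>A condition inside the sum, instead of a shifted index, lets the sums over
  \<open>N\<close> and \<open>n\<close> be interchanged later.\<close>

definition tail :: "nat \<Rightarrow> real" where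
  "tail N = (\<Sum>n. if N \<le> n then q2 n else 0)"

lemma tail_summable: "summable (\<lambda>n. if N \<le> n then q2 n else 0)"
  by (rule summable_comparison_test'[OF square_summable]) (simp add: q2_def)

lemma tail_nonneg: "0 \<le> tail N"
  unfolding tail_def by (intro suminf_nonneg tail_summable) simp

lemma sum_le_tail: "(\<Sum>n\<in>{N..<K}. q2 n) \<le> tail N"
proof -
  have "(\<Sum>n\<in>{N..<K}. q2 n) = (\<Sum>n\<in>{N..<K}. if N \<le> n then q2 n else 0)"
    by (intro sum.cong) auto
  also have "\<dots> \<le> tail N" unfolding tail_def by (intro sum_le_suminf tail_summable) auto
  finally show ?thesis .
qed

lemma tail_tendsto_0: "tail \<longlonglongrightarrow> 0"
proof -
  have sm: "summable q2" using square_summable by (simp add: q2_def[abs_def])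
  have "tail N = suminf q2 - (\<Sum>n<N. q2 n)" for N
  proof -
    have "suminf q2 = (\<Sum>n. (if N \<le> n then q2 n else 0) + (if n < N then q2 n else 0))"
      by (intro suminf_cong) auto
    also have "\<dots> = tail N + (\<Sum>n. if n < N then q2 n else 0)"
      unfolding tail_def by (subst suminf_add[OF tail_summable, symmetric])
        (auto intro: summable_finite[of "{..<N}"])
    also have "(\<Sum>n. if n < N then q2 n else 0) = (\<Sum>n<N. q2 n)"
      by (subst suminf_finite[of "{..<N}"]) auto
    finally show ?thesis by simp
  qed
  moreover have "(\<lambda>N. suminf q2 - (\<Sum>n<N. q2 n)) \<longlonglongrightarrow> suminf q2 - suminf q2"
    by (intro tendsto_diff tendsto_const summable_LIMSEQ sm)
  ultimately have "(\<lambda>N. tail N) \<longlonglongrightarrow> suminf q2 - suminf q2" by presburger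
  then show ?thesis by simp
qed

lemma L_diff_square:
  assumes "N \<le> K"
  shows "integrable M (\<lambda>x. (norm (L K x - L N x))\<^sup>2)"
    and "(LINT x|M. (norm (L K x - L N x))\<^sup>2) \<le> tail N"
proof -
  have eq: "L K x - L N x = (\<Sum>n\<in>{N..<K}. F n x)" for x
    using assms by (simp add: L_def sum_diff_nat_ivl atLeast0LessThan sum.atLeastLessThan_concat
       flip: atLeast0LessThan)
  show "integrable M (\<lambda>x. (norm (L K x - L N x))\<^sup>2)"
    unfolding eq by (rule integral_square_sum)
  show "(LINT x|M. (norm (L K x - L N x))\<^sup>2) \<le> tail N"
    unfolding eq using sum_le_tail by (simp add: integral_square_sum)
qed

text \<open>On a probability space, nonnegativity of the variance of \<open>norm (h x)\<close> is
  the Cauchy-Schwarz inequality against the constant \<open>1\<close>.\<close>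

lemma L1_le_L2:
  assumes [measurable]: "h \<in> borel_measurable M" and h: "integrable M (\<lambda>x. (norm (h x :: complex))\<^sup>2)"
  shows "integrable M h" "(LINT x|M. norm (h x)) \<le> sqrt (LINT x|M. (norm (h x))\<^sup>2)"
proof -
  have i: "integrable M (\<lambda>x. norm (h x))"
    by (rule square_integrable_imp_integrable) (use h in auto)
  then show "integrable M h" by (subst (asm) integrable_norm_iff) auto
  have "0 \<le> variance (\<lambda>x. norm (h x))" by (rule variance_positive)
  also have "\<dots> = (LINT x|M. (norm (h x))\<^sup>2) - (LINT x|M. norm (h x))\<^sup>2"
    by (rule variance_eq[OF i h])
  finally show "(LINT x|M. norm (h x)) \<le> sqrt (LINT x|M. (norm (h x))\<^sup>2)"
    by (intro real_le_rsqrt) simp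
qed

lemma L_diff_norm:
  assumes "tail N < e\<^sup>2" "0 < e" "N \<le> K"
  shows "(LINT x|M. norm (L K x - L N x)) < e"
proof -
  have "(LINT x|M. norm (L K x - L N x)) \<le> sqrt (LINT x|M. (norm (L K x - L N x))\<^sup>2)"
    by (intro L1_le_L2 L_diff_square assms) measurable
  also have "\<dots> \<le> sqrt (tail N)" by (intro real_sqrt_le_mono L_diff_square assms)
  also have "\<dots> < e" using assms by (intro real_less_lsqrt tail_nonneg) auto
  finally show ?thesis .
qed

text \<open>The tail bound makes the partial sums Cauchy in \<open>L^1\<close>, so a subsequence
  converges almost everywhere. It provides a pointwise limit; \<open>L^1\<close> convergence of the
  full sequence to that limit is recovered afterwards.\<close>

lemma AE_convergent_subseq:
  obtains g r where "g \<in> borel_measurable M" "strict_mono r" "AE x in M. (\<lambda>i. L (r i) x) \<longlonglongrightarrow> g x"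
proof -
  have "\<exists>N. \<forall>i\<ge>N. \<forall>j\<ge>N. (LINT x|M. norm (L i x - L j x)) < e" if "e > 0" for e
  proof -
    have "\<forall>\<^sub>F N in sequentially. tail N < e\<^sup>2"
      using that by (intro order_tendstoD[OF tail_tendsto_0]) simp
    then obtain N where N: "\<And>n. n \<ge> N \<Longrightarrow> tail n < e\<^sup>2" by (auto simp: eventually_sequentially)
    have "(LINT x|M. norm (L i x - L j x)) < e" if "i \<ge> N" "j \<ge> N" for i j
    proof (cases "i \<le> j")
      case True
      then have "(LINT x|M. norm (L j x - L i x)) < e"
        using that N \<open>e > 0\<close> by (intro L_diff_norm) auto
      then show ?thesis by (simp add: norm_minus_commute)
    next
      case False
      then show ?thesis using that N \<open>e > 0\<close> by (intro L_diff_norm) auto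
    qed
    then show ?thesis by blast
  qed
  from cauchy_L1_AE_cauchy_subseq[OF L_integrable this]
  obtain r where r: "strict_mono r" "AE x in M. Cauchy (\<lambda>i. L (r i) x)" by blast
  show ?thesis
  proof
    show "(\<lambda>x. lim (\<lambda>i. L (r i) x)) \<in> borel_measurable M" by (rule borel_measurable_lim_metric) measurable
    show "AE x in M. (\<lambda>i. L (r i) x) \<longlonglongrightarrow> lim (\<lambda>i. L (r i) x)"
      using r(2) by eventually_elim (simp add: Cauchy_convergent_iff convergent_LIMSEQ_iff)
  qed (fact r)
qed

section \<open>The limit function and its \<open>L^p\<close> norm\<close>

context
  fixes g r
  assumes g [measurable]: "g \<in> borel_measurable M"
    and r: "strict_mono r" and lim: "AE x in M. (\<lambda>i. L (r i) x) \<longlonglongrightarrow> g x"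
begin

text \<open>Fatou's lemma along the subsequence: \<open>r i\<close> eventually exceeds
  \<open>N\<close>, and from then on each difference has squared \<open>L^2\<close> norm at most
  \<open>tail N\<close>.\<close>

lemma nn_integral_limit_diff: "(\<integral>\<^sup>+x. ennreal ((norm (g x - L N x))\<^sup>2) \<partial>M) \<le> ennreal (tail N)"
proof -
  have "(\<integral>\<^sup>+x. ennreal ((norm (g x - L N x))\<^sup>2) \<partial>M)
      = (\<integral>\<^sup>+x. liminf (\<lambda>i. ennreal ((norm (L (r i) x - L N x))\<^sup>2)) \<partial>M)"
  proof (rule nn_integral_cong_AE, use lim in eventually_elim)
    fix x assume "(\<lambda>i. L (r i) x) \<longlonglongrightarrow> g x"
    then have "(\<lambda>i. ennreal ((norm (L (r i) x - L N x))\<^sup>2)) \<longlonglongrightarrow> ennreal ((norm (g x - L N x))\<^sup>2)"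
      by (intro tendsto_intros)
    then show "ennreal ((norm (g x - L N x))\<^sup>2) = liminf (\<lambda>i. ennreal ((norm (L (r i) x - L N x))\<^sup>2))"
      by (intro lim_imp_Liminf[symmetric]) auto
  qed
  also have "\<dots> \<le> liminf (\<lambda>i. \<integral>\<^sup>+x. ennreal ((norm (L (r i) x - L N x))\<^sup>2) \<partial>M)"
    by (rule nn_integral_liminf) measurable
  also have "\<dots> \<le> ennreal (tail N)"
  proof (rule Liminf_le)
    have "\<forall>\<^sub>F i in sequentially. N \<le> r i"
      using filterlim_subseq[OF r] by (auto simp: filterlim_at_top)
    then show "\<forall>\<^sub>F i in sequentially. (\<integral>\<^sup>+x. ennreal ((norm (L (r i) x - L N x))\<^sup>2) \<partial>M) \<le> ennreal (tail N)"
    proof eventually_elim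
      case (elim i)
      have "(\<integral>\<^sup>+x. ennreal ((norm (L (r i) x - L N x))\<^sup>2) \<partial>M)
          = ennreal (LINT x|M. (norm (L (r i) x - L N x))\<^sup>2)"
        by (rule nn_integral_eq_integral) (use L_diff_square(1)[OF elim] in auto)
      also have "\<dots> \<le> ennreal (tail N)" by (intro ennreal_leI L_diff_square elim)
      finally show ?case .
    qed
  qed simp
  finally show ?thesis .
qed

lemma limit_diff_square: "integrable M (\<lambda>x. (norm (g x - L N x))\<^sup>2)" "(LINT x|M. (norm (g x - L N x))\<^sup>2) \<le> tail N"
proof -
  show *: "integrable M (\<lambda>x. (norm (g x - L N x))\<^sup>2)"
    by (rule integrableI_bounded) (use nn_integral_limit_diff[of N] in \<open>auto simp: le_less_trans\<close>)
  have "ennreal (LINT x|M. (norm (g x - L N x))\<^sup>2) \<le> ennreal (tail N)"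
    using nn_integral_limit_diff[of N] nn_integral_eq_integral[OF *] by simp
  then show "(LINT x|M. (norm (g x - L N x))\<^sup>2) \<le> tail N" by (simp add: tail_nonneg)
qed

lemma limit_integrable: "integrable M g"
  \<comment> \<open>For \<open>N = 0\<close> the partial sum is empty, so \<open>g\<close> itself is
    square integrable.\<close>
  using L1_le_L2(1)[of g] limit_diff_square(1)[of 0] by (simp add: L_def)

lemma L_tendsto_L1: "(\<lambda>N. LINT x|M. norm (g x - L N x)) \<longlonglongrightarrow> 0"
proof (rule Lim_null_comparison)
  show "\<forall>\<^sub>F N in sequentially. norm (LINT x|M. norm (g x - L N x)) \<le> sqrt (tail N)"
  proof (rule always_eventually, rule allI)
    fix N
    have "(LINT x|M. norm (g x - L N x)) \<le> sqrt (LINT x|M. (norm (g x - L N x))\<^sup>2)"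
      by (intro L1_le_L2 limit_diff_square) measurable
    also have "\<dots> \<le> sqrt (tail N)" by (intro real_sqrt_le_mono limit_diff_square)
    finally show "norm (LINT x|M. norm (g x - L N x)) \<le> sqrt (tail N)" by simp
  qed
  show "(\<lambda>N. sqrt (tail N)) \<longlonglongrightarrow> 0" using tendsto_real_sqrt[OF tail_tendsto_0] by simp
qed

text \<open>Convergence in \<open>L^1\<close> passes to integrals against bounded functions. Applied
  to matrix entries, this identifies the Fourier coefficients of the limit.\<close>

lemma integral_limit:
  assumes [measurable]: "h \<in> borel_measurable M" and h: "\<And>x. x \<in> space M \<Longrightarrow> norm (h x) \<le> B"
  shows "(\<lambda>N. LINT x|M. L N x * h x) \<longlonglongrightarrow> (LINT x|M. g x * h x)"
proof -
  have int: "integrable M (\<lambda>x. k x * h x)" if "integrable M k" for k :: "'a \<Rightarrow> complex"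
    using that assms by (rule integrable_mult_bounded)
  have "(\<lambda>N. (LINT x|M. g x * h x) - (LINT x|M. L N x * h x)) \<longlonglongrightarrow> 0"
  proof (rule Lim_null_comparison)
    show "(\<lambda>N. \<bar>B\<bar> * (LINT x|M. norm (g x - L N x))) \<longlonglongrightarrow> 0"
      using tendsto_mult_right_zero[OF L_tendsto_L1] .
    show "\<forall>\<^sub>F N in sequentially. norm ((LINT x|M. g x * h x) - (LINT x|M. L N x * h x))
        \<le> \<bar>B\<bar> * (LINT x|M. norm (g x - L N x))"
    proof (rule always_eventually, rule allI)
      fix N
      have d: "integrable M (\<lambda>x. g x - L N x)" by (intro Bochner_Integration.integrable_diff limit_integrable L_integrable)
      have "norm ((LINT x|M. g x * h x) - (LINT x|M. L N x * h x)) = norm (LINT x|M. (g x - L N x) * h x)"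
        by (subst Bochner_Integration.integral_diff[symmetric], (intro int limit_integrable L_integrable)+)
           (simp only: left_diff_distrib)
      also have "\<dots> \<le> (LINT x|M. norm ((g x - L N x) * h x))" by (rule integral_norm_bound)
      also have "\<dots> \<le> (LINT x|M. \<bar>B\<bar> * norm (g x - L N x))"
      proof (rule integral_mono)
        show "integrable M (\<lambda>x. norm ((g x - L N x) * h x))" using int[OF d] by (rule integrable_norm)
        show "norm ((g x - L N x) * h x) \<le> \<bar>B\<bar> * norm (g x - L N x)" if "x \<in> space M" for x
        proof -
          have "norm (h x) \<le> \<bar>B\<bar>" using h[OF that] by linarith
          then show ?thesis by (simp add: norm_mult mult.commute[of "norm (g x - L N x)"] mult_right_mono)
        qed
      qed (use d in auto)
      finally show "norm ((LINT x|M. g x * h x) - (LINT x|M. L N x * h x))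
        \<le> \<bar>B\<bar> * (LINT x|M. norm (g x - L N x))" by simp
    qed
  qed
  from tendsto_diff[OF tendsto_const[of "LINT x|M. g x * h x"] this] show ?thesis by simp
qed

text \<open>Integrating the layer decomposition of \<open>norm (g x) powr p\<close> bounds it by the
  tails, weighted with the increments of \<open>s powr (p - 2)\<close>. Interchanging the sums turns
  these weights into powers of partial sums of \<open>b\<close>, to which
  \<open>weighted_square_sum_le\<close> applies.\<close>

lemma limit_Lp:
  assumes p: "2 \<le> p" and sm: "summable (\<lambda>n. (real n + 1) powr (p - 4) * b n powr p)"
  defines "C \<equiv> 4 * 2 powr (p - 2) * (1 + (4 * p) powr p)"
  shows "integrable M (\<lambda>x. norm (g x) powr p)"
    and "(LINT x|M. norm (g x) powr p) \<le> C * (\<Sum>n. (real n + 1) powr (p - 4) * b n powr p)"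
proof -
  define s where "s N = 2 * (\<Sum>n<N. b n)" for N
  have s: "mono s" "s 0 = 0"
    by (auto simp: s_def incseq_Suc_iff b_nonneg)
  have s0: "0 \<le> s N" for N by (simp add: s_def sum_nonneg b_nonneg)
  define \<delta> where "\<delta> N = 4 * (s (Suc N) powr (p - 2) - s N powr (p - 2))" for N
  have \<delta>0: "0 \<le> \<delta> N" for N
    using powr_mono2[of "p - 2" "s N" "s (Suc N)"] p s s0 by (auto simp: \<delta>_def mono_def)
  \<comment> \<open>After the interchange, \<open>q2 n\<close> is counted once for each layer
    \<open>N \<le> n\<close>; the total weight telescopes to the level \<open>s (Suc n)\<close>,
    which includes \<open>b n\<close>.\<close>
  have \<delta>_sum: "(\<Sum>N\<le>n. \<delta> N) = 4 * 2 powr (p - 2) * (\<Sum>k\<le>n. b k) powr (p - 2)" for n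
  proof -
    have "(\<Sum>N\<le>n. \<delta> N) = 4 * s (Suc n) powr (p - 2)"
      using s unfolding \<delta>_def lessThan_Suc_atMost[symmetric] sum_distrib_left[symmetric]
      by (simp only: sum_lessThan_telescope[of "\<lambda>N. s N powr (p - 2)"]) simp
    then show ?thesis
      by (simp add: s_def powr_mult sum_nonneg b_nonneg flip: lessThan_Suc_atMost del: sum.lessThan_Suc)
  qed
  have "AE x in M. ennreal (norm (g x) powr p) \<le> (\<Sum>N. ennreal (\<delta> N) * ennreal ((norm (g x - L N x))\<^sup>2))"
    using lim AE_space
  proof eventually_elim
    case (elim x)
    have L2: "2 * norm (L N x) \<le> s N" for N using L_bound[OF elim(2)] by (simp add: s_def)
    \<comment> \<open>The levels may stay bounded. If all were below \<open>norm (g x)\<close>, the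
      factor \<open>2\<close> in \<open>s\<close> would give
      \<open>2 * norm (g x) \<le> norm (g x)\<close> in the limit, contradicting
      \<open>s 0 < norm (g x)\<close>.\<close>
    have "\<exists>K. norm (g x) \<le> s K"
    proof (rule ccontr)
      assume "\<not> ?thesis"
      then have less: "s K < norm (g x)" for K by (simp add: not_le)
      have "(\<lambda>i. 2 * norm (L (r i) x)) \<longlonglongrightarrow> 2 * norm (g x)" using elim(1) by (intro tendsto_intros)
      then have "2 * norm (g x) \<le> norm (g x)"
        by (rule LIMSEQ_le_const2) (use L2 less in \<open>meson less_imp_le order_trans\<close>)
      with less[of 0] s show False by simp
    qed
    then obtain K where "norm (g x) \<le> s K" by blast
    from norm_powr_le_layers[OF p L2 s this] obtain K where
      K: "norm (g x) powr p \<le> (\<Sum>N<K. \<delta> N * (norm (g x - L N x))\<^sup>2)"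
      unfolding \<delta>_def by blast
    then have "ennreal (norm (g x) powr p) \<le> ennreal (\<Sum>N<K. \<delta> N * (norm (g x - L N x))\<^sup>2)"
      by (rule ennreal_leI)
    also have "\<dots> = (\<Sum>N<K. ennreal (\<delta> N) * ennreal ((norm (g x - L N x))\<^sup>2))"
      using \<delta>0 by (subst sum_ennreal[symmetric]) (auto simp: ennreal_mult)
    also have "\<dots> \<le> (\<Sum>N. ennreal (\<delta> N) * ennreal ((norm (g x - L N x))\<^sup>2))"
      by (rule sum_le_suminf) auto
    finally show ?case .
  qed
  then have "(\<integral>\<^sup>+x. ennreal (norm (g x) powr p) \<partial>M)
      \<le> (\<integral>\<^sup>+x. (\<Sum>N. ennreal (\<delta> N) * ennreal ((norm (g x - L N x))\<^sup>2)) \<partial>M)"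
    by (rule nn_integral_mono_AE)
  also have "\<dots> = (\<Sum>N. ennreal (\<delta> N) * (\<integral>\<^sup>+x. ennreal ((norm (g x - L N x))\<^sup>2) \<partial>M))"
    by (subst nn_integral_suminf) (auto simp: nn_integral_cmult)
  also have "\<dots> \<le> (\<Sum>N. ennreal (\<delta> N) * ennreal (tail N))"
    by (intro suminf_le mult_left_mono nn_integral_limit_diff) auto
  also have "\<dots> = (\<Sum>N. ennreal (\<delta> N) * (\<Sum>n. ennreal (if N \<le> n then q2 n else 0)))"
    unfolding tail_def by (subst suminf_ennreal2) (auto intro: tail_summable)
  also have "\<dots> = (\<Sum>N. \<Sum>n. ennreal (\<delta> N) * ennreal (if N \<le> n then q2 n else 0))"
    by simp
  also have "\<dots> = (\<Sum>n. \<Sum>N. ennreal (\<delta> N) * ennreal (if N \<le> n then q2 n else 0))"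
    by (rule suminf_ennreal_commute)
  also have "\<dots> = (\<Sum>n. \<Sum>N\<le>n. ennreal (\<delta> N) * ennreal (q2 n))"
    by (intro suminf_cong) (simp flip: ennreal_suminf_if_le add: if_distrib cong: if_cong)
  also have "\<dots> = (\<Sum>n. ennreal (q2 n * (\<Sum>N\<le>n. \<delta> N)))"
    using \<delta>0 by (intro suminf_cong)
      (simp add: sum_distrib_left ennreal_mult mult.commute flip: sum_ennreal)
  also have "\<dots> \<le> ennreal (C * (\<Sum>n. (real n + 1) powr (p - 4) * b n powr p))"
  proof (rule suminf_le_const)
    fix K
    have "(\<Sum>n<K. ennreal (q2 n * (\<Sum>N\<le>n. \<delta> N))) = ennreal (\<Sum>n<K. q2 n * (\<Sum>N\<le>n. \<delta> N))"
      using \<delta>0 by (intro sum_ennreal) (auto intro!: mult_nonneg_nonneg sum_nonneg)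
    also have "\<dots> \<le> ennreal (C * (\<Sum>n. (real n + 1) powr (p - 4) * b n powr p))"
    proof (rule ennreal_leI)
      have "(\<Sum>n<K. q2 n * (\<Sum>N\<le>n. \<delta> N)) \<le> (\<Sum>n\<le>K. q2 n * (\<Sum>N\<le>n. \<delta> N))"
        using \<delta>0 by (intro sum_mono2) (auto intro!: mult_nonneg_nonneg sum_nonneg)
      also have "\<dots> = 4 * 2 powr (p - 2) * (\<Sum>n\<le>K. (b n / (real n + 1))\<^sup>2 * (\<Sum>k\<le>n. b k) powr (p - 2))"
        by (simp add: \<delta>_sum q2_def sum_distrib_left mult_ac)
      also have "\<dots> \<le> 4 * 2 powr (p - 2) * ((1 + (4 * p) powr p) * (\<Sum>n\<le>K. (real n + 1) powr (p - 4) * b n powr p))"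
        by (intro mult_left_mono weighted_square_sum_le b_nonneg p) auto
      also have "\<dots> \<le> 4 * 2 powr (p - 2) * ((1 + (4 * p) powr p) * (\<Sum>n. (real n + 1) powr (p - 4) * b n powr p))"
        by (intro mult_left_mono sum_le_suminf sm) auto
      finally show "(\<Sum>n<K. q2 n * (\<Sum>N\<le>n. \<delta> N)) \<le> C * (\<Sum>n. (real n + 1) powr (p - 4) * b n powr p)"
        by (simp add: C_def mult_ac)
    qed
    finally show "(\<Sum>n<K. ennreal (q2 n * (\<Sum>N\<le>n. \<delta> N))) \<le> ennreal (C * (\<Sum>n. (real n + 1) powr (p - 4) * b n powr p))" .
  qed auto
  finally have bound: "(\<integral>\<^sup>+x. ennreal (norm (g x) powr p) \<partial>M)
      \<le> ennreal (C * (\<Sum>n. (real n + 1) powr (p - 4) * b n powr p))" .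
  show int: "integrable M (\<lambda>x. norm (g x) powr p)"
    by (rule integrableI_bounded) (use bound in \<open>auto simp: le_less_trans\<close>)
  have "0 \<le> C * (\<Sum>n. (real n + 1) powr (p - 4) * b n powr p)"
    using sm p by (auto simp: C_def intro!: mult_nonneg_nonneg suminf_nonneg add_nonneg_nonneg)
  moreover have "ennreal (LINT x|M. norm (g x) powr p) \<le> ennreal (C * (\<Sum>n. (real n + 1) powr (p - 4) * b n powr p))"
    using bound nn_integral_eq_integral[OF int] by simp
  ultimately show "(LINT x|M. norm (g x) powr p) \<le> C * (\<Sum>n. (real n + 1) powr (p - 4) * b n powr p)"
    by simp
qed

end

end

section \<open>The group and its invariant kernels\<close>

lemma vector_matrix_mult_2:
  fixes z :: "complex^2" and u :: "complex^2^2"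
  shows "(z v* u) $ j = z $ 1 * u $ 1 $ j + z $ 2 * u $ 2 $ j"
  by (simp add: vector_matrix_mult_def sum_2)

section \<open>Coordinates and compactness of SU(2)\<close>

definition su2_matrix :: "complex \<Rightarrow> complex \<Rightarrow> complex^2^2" where
  "su2_matrix a b = vector [vector [a, b], vector [- cnj b, cnj a]]"

lemma su2_matrix_nth [simp]:
  "su2_matrix a b $ 1 $ 1 = a" "su2_matrix a b $ 1 $ 2 = b"
  "su2_matrix a b $ 2 $ 1 = - cnj b" "su2_matrix a b $ 2 $ 2 = cnj a"
  by (simp_all add: su2_matrix_def)

text \<open>The first row determines the second: one orthogonality relation and the determinant
  condition are solved for its entries by Cramer's rule.\<close>

lemma SU2_iff:
  "u \<in> SU2 \<longleftrightarrow> u $ 2 $ 2 = cnj (u $ 1 $ 1) \<and> u $ 2 $ 1 = - cnj (u $ 1 $ 2)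
     \<and> u $ 1 $ 1 * cnj (u $ 1 $ 1) + u $ 1 $ 2 * cnj (u $ 1 $ 2) = 1"
proof -
  define a b c d where "a = u $ 1 $ 1" and "b = u $ 1 $ 2" and "c = u $ 2 $ 1" and "d = u $ 2 $ 2"
  have "u \<in> SU2 \<longleftrightarrow> (a * cnj a + b * cnj b = 1 \<and> a * cnj c + b * cnj d = 0 \<and>
      c * cnj a + d * cnj b = 0 \<and> c * cnj c + d * cnj d = 1) \<and> a * d - b * c = 1"
  proof -
    have "A = B \<longleftrightarrow> A $ 1 $ 1 = B $ 1 $ 1 \<and> A $ 1 $ 2 = B $ 1 $ 2 \<and> A $ 2 $ 1 = B $ 2 $ 1 \<and> A $ 2 $ 2 = B $ 2 $ 2"
      for A B :: "complex^2^2"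
      unfolding Finite_Cartesian_Product.vec_eq_iff forall_2 by blast
    from this[of "u ** conj_transpose u" "Finite_Cartesian_Product.mat 1"] show ?thesis
      unfolding SU2_def mem_Collect_eq Determinants.det_2
      by (simp add: a_def b_def c_def d_def matrix_matrix_mult_def conj_transpose_def
        Finite_Cartesian_Product.mat_def sum_2)
  qed
  also have "\<dots> \<longleftrightarrow> d = cnj a \<and> c = - cnj b \<and> a * cnj a + b * cnj b = 1"
  proof (intro iffI)
    assume *: "(a * cnj a + b * cnj b = 1 \<and> a * cnj c + b * cnj d = 0 \<and>
      c * cnj a + d * cnj b = 0 \<and> c * cnj c + d * cnj d = 1) \<and> a * d - b * c = 1"
    then have "a * cnj a + b * cnj b = 1" "c * cnj a + d * cnj b = 0" "a * d - b * c = 1" by auto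
    moreover have "d * (a * cnj a + b * cnj b) = cnj a * (a * d - b * c) + b * (c * cnj a + d * cnj b)"
      "c * (a * cnj a + b * cnj b) = a * (c * cnj a + d * cnj b) - cnj b * (a * d - b * c)"
      by (simp_all add: algebra_simps)
    ultimately show "d = cnj a \<and> c = - cnj b \<and> a * cnj a + b * cnj b = 1" by simp
  next
    assume "d = cnj a \<and> c = - cnj b \<and> a * cnj a + b * cnj b = 1"
    moreover from this have "b * cnj b + a * cnj a = 1" by (simp add: add.commute)
    ultimately show "(a * cnj a + b * cnj b = 1 \<and> a * cnj c + b * cnj d = 0 \<and>
      c * cnj a + d * cnj b = 0 \<and> c * cnj c + d * cnj d = 1) \<and> a * d - b * c = 1"
      by (simp add: mult.commute)
  qed
  finally show ?thesis by (simp add: a_def b_def c_def d_def)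
qed

lemma su2_matrix_in_SU2: "a * cnj a + b * cnj b = 1 \<Longrightarrow> su2_matrix a b \<in> SU2"
  by (simp add: SU2_iff)

lemma SU2_det: "u \<in> SU2 \<Longrightarrow> u $ 1 $ 1 * u $ 2 $ 2 - u $ 1 $ 2 * u $ 2 $ 1 = 1"
  by (simp add: SU2_iff)

lemma SU2_mult:
  assumes "u \<in> SU2" "v \<in> SU2"
  shows "u ** v \<in> SU2"
proof -
  have "u $ 1 $ 1 * cnj (u $ 1 $ 1) + u $ 1 $ 2 * cnj (u $ 1 $ 2) = 1"
    "v $ 1 $ 1 * cnj (v $ 1 $ 1) + v $ 1 $ 2 * cnj (v $ 1 $ 2) = 1"
    using assms by (simp_all add: SU2_iff)
  \<comment> \<open>The primed letters stand for the conjugates; as independent variables they turn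
    multiplicativity of the norm form into a polynomial identity.\<close>
  moreover have "(a * c - b * d') * (a' * c' - b' * d) + (a * d + b * c') * (a' * d' + b' * c)
      = (a * a' + b * b') * (c * c' + d * d')" for a b c d a' b' c' d' :: complex
    by (simp add: algebra_simps)
  ultimately show ?thesis
    using assms by (simp add: SU2_iff matrix_matrix_mult_def sum_2)
qed

lemma norm_SU2_nth_le:
  assumes "u \<in> SU2"
  shows "norm (u $ i $ j) \<le> 1"
proof -
  have "complex_of_real ((norm (u $ 1 $ 1))\<^sup>2 + (norm (u $ 1 $ 2))\<^sup>2) = 1"
    using assms by (simp add: SU2_iff complex_norm_square del: of_real_power)
  then have *: "(norm (u $ 1 $ 1))\<^sup>2 + (norm (u $ 1 $ 2))\<^sup>2 = 1" by (simp only: of_real_eq_1_iff)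
  have "(norm (u $ 1 $ 1))\<^sup>2 \<le> 1" "(norm (u $ 1 $ 2))\<^sup>2 \<le> 1"
    using * zero_le_power2[of "norm (u $ 1 $ 1)"] zero_le_power2[of "norm (u $ 1 $ 2)"] by linarith+
  then have "norm (u $ 1 $ 1) \<le> 1" "norm (u $ 1 $ 2) \<le> 1" by (simp_all add: abs_square_le_1)
  then show ?thesis
    using assms exhaust_2[of i] exhaust_2[of j] by (auto simp: SU2_iff)
qed

lemma compact_SU2: "compact SU2"
proof (rule compact_eq_bounded_closed[THEN iffD2], intro conjI)
  show "bounded SU2"
    unfolding bounded_iff
  proof (intro exI[of _ 4] ballI)
    fix u :: "complex^2^2" assume u: "u \<in> SU2"
    have "norm u \<le> (\<Sum>i\<in>UNIV. norm (u $ i))"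
      unfolding norm_vec_def[of u] by (rule L2_set_le_sum) simp
    also have "\<dots> \<le> (\<Sum>i\<in>UNIV. \<Sum>j\<in>UNIV. norm (u $ i $ j))"
      unfolding norm_vec_def[of "u $ _"] by (intro sum_mono L2_set_le_sum) simp
    also have "\<dots> \<le> (\<Sum>i\<in>(UNIV :: 2 set). \<Sum>j\<in>(UNIV :: 2 set). 1)"
      by (intro sum_mono norm_SU2_nth_le u)
    finally show "norm u \<le> 4" by simp
  qed
  have "SU2 = {u. u $ 2 $ 2 = cnj (u $ 1 $ 1)} \<inter> {u. u $ 2 $ 1 = - cnj (u $ 1 $ 2)}
     \<inter> {u. u $ 1 $ 1 * cnj (u $ 1 $ 1) + u $ 1 $ 2 * cnj (u $ 1 $ 2) = 1}"
    by (auto simp: SU2_iff)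
  also have "closed \<dots>"
    by (intro closed_Int closed_Collect_eq continuous_intros)
  finally show "closed SU2" .
qed

lemma SU2_borel [measurable]: "SU2 \<in> sets borel"
  using compact_SU2 by (intro borel_closed compact_imp_closed)

section \<open>Homogeneous polynomials and invariant kernels\<close>

definition hom_monomial :: "nat \<Rightarrow> nat \<Rightarrow> complex^2 \<Rightarrow> complex" where
  "hom_monomial n k z = (z $ 1) ^ k * (z $ 2) ^ (n - k)"

lemma hom_polys_iff: "P \<in> hom_polys n \<longleftrightarrow> (\<exists>a. \<forall>z. P z = (\<Sum>k\<le>n. a k * hom_monomial n k z))"
  by (simp add: hom_polys_def hom_monomial_def mult.assoc)

lemma hom_monomial_in_hom_polys: "k \<le> n \<Longrightarrow> hom_monomial n k \<in> hom_polys n"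
  unfolding hom_polys_iff by (intro exI[of _ "\<lambda>i. if i = k then 1 else 0"]) (simp add: if_distrib if_distribR cong: if_cong)

lemma hom_polys_sum:
  assumes "\<And>i. i \<in> I \<Longrightarrow> P i \<in> hom_polys n"
  shows "(\<lambda>z. \<Sum>i\<in>I. c i * P i z) \<in> hom_polys n"
proof -
  have "\<forall>i\<in>I. \<exists>a. \<forall>z. P i z = (\<Sum>k\<le>n. a k * hom_monomial n k z)"
    using assms by (simp add: hom_polys_iff)
  then obtain a where a: "\<And>i z. i \<in> I \<Longrightarrow> P i z = (\<Sum>k\<le>n. a i k * hom_monomial n k z)"
    by metis
  show ?thesis
    unfolding hom_polys_iff
  proof (intro exI[of _ "\<lambda>k. \<Sum>i\<in>I. c i * a i k"] allI)
    fix z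
    have "(\<Sum>i\<in>I. c i * P i z) = (\<Sum>i\<in>I. \<Sum>k\<le>n. c i * a i k * hom_monomial n k z)"
      by (intro sum.cong refl) (simp add: a sum_distrib_left mult.assoc)
    also have "\<dots> = (\<Sum>k\<le>n. (\<Sum>i\<in>I. c i * a i k) * hom_monomial n k z)"
      by (subst sum.swap) (simp add: sum_distrib_right)
    finally show "(\<Sum>i\<in>I. c i * P i z) = (\<Sum>k\<le>n. (\<Sum>i\<in>I. c i * a i k) * hom_monomial n k z)" .
  qed
qed

lemma hom_polys_scale:
  assumes "P \<in> hom_polys n"
  shows "P (c *s z) = c ^ n * P z"
proof -
  obtain a where a: "\<And>z. P z = (\<Sum>k\<le>n. a k * hom_monomial n k z)"
    using assms by (auto simp: hom_polys_iff)
  have "hom_monomial n k (c *s z) = c ^ n * hom_monomial n k z" if "k \<le> n" for k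
  proof -
    have "c ^ n = c ^ k * c ^ (n - k)" using that by (simp flip: power_add)
    then show ?thesis by (simp add: hom_monomial_def power_mult_distrib)
  qed
  then show ?thesis
    unfolding a sum_distrib_left by (intro sum.cong) (auto simp: mult.left_commute)
qed

lemma hom_polys_continuous:
  assumes "P \<in> hom_polys n" "continuous_on S g"
  shows "continuous_on S (\<lambda>u. P (g u))"
proof -
  obtain a where "\<And>z. P z = (\<Sum>k\<le>n. a k * hom_monomial n k z)"
    using assms by (auto simp: hom_polys_iff)
  then show ?thesis
    unfolding hom_monomial_def using assms(2) by (auto intro!: continuous_intros)
qed

text \<open>Setting \<open>z = (x, 1)\<close> reduces the claim to polynomials in one
  variable.\<close>

lemma hom_monomials_independent:
  assumes "\<And>z. (\<Sum>k\<le>n. a k * hom_monomial n k z) = 0" "k \<le> n"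
  shows "a k = 0"
proof -
  have "(\<Sum>k\<le>n. a k * x ^ k) = 0" for x
    using assms(1)[of "vector [x, 1]"] by (simp add: hom_monomial_def)
  then show ?thesis using polyfun_eq_0[of a n] assms(2) by blast
qed

text \<open>A kernel with these symmetries is determined by \<open>K z e\<^sub>1\<close>, because \<open>SU(2)\<close> acts
  transitively on spheres, and the diagonal torus leaves a single monomial in \<open>K z e\<^sub>1\<close>.\<close>

lemma SU2_invariant_kernel:
  fixes K :: "complex^2 \<Rightarrow> complex^2 \<Rightarrow> complex"
  assumes hom: "\<And>w. (\<lambda>z. K z w) \<in> hom_polys n"
    and scale: "\<And>z w c. K z (c *s w) = cnj c ^ m * K z w"
    and inv: "\<And>z w v. v \<in> SU2 \<Longrightarrow> K (z v* v) (w v* v) = K z w"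
    and "n \<le> m"
  shows "\<exists>c. (n < m \<longrightarrow> c = 0) \<and> (\<forall>z w. K z w = c * (z $ 1 * cnj (w $ 1) + z $ 2 * cnj (w $ 2)) ^ n)"
proof -
  define e :: "complex^2" where "e = vector [1, 0]"
  obtain a where a: "\<And>z. K z e = (\<Sum>k\<le>n. a k * hom_monomial n k z)"
    using hom[of e] by (auto simp: hom_polys_iff)
  \<comment> \<open>Small enough that \<open>(n + m - 2 * k) * \<theta>\<close> lies between
    \<open>0\<close> and \<open>pi\<close> for each unwanted exponent \<open>k\<close>, so that a
    single torus element excludes all of them.\<close>
  define \<theta> where "\<theta> = pi / real (n + m + 1)"
  define v where "v = su2_matrix (cis \<theta>) 0"
  have v: "v \<in> SU2" unfolding v_def by (rule su2_matrix_in_SU2) (simp add: cis_cnj cis_mult)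
  have ev: "e v* v = cis \<theta> *s e"
    by (simp add: Finite_Cartesian_Product.vec_eq_iff forall_2 vector_matrix_mult_2 e_def v_def)
  have zv: "hom_monomial n k (z v* v) = cis \<theta> ^ k * cis (- \<theta>) ^ (n - k) * hom_monomial n k z" for z k
    by (simp add: hom_monomial_def vector_matrix_mult_2 v_def power_mult_distrib cis_cnj mult_ac)
  \<comment> \<open>Acting by \<open>v\<close>, which only multiplies \<open>e\<close> by a phase,
    multiplies the \<open>k\<close>-th coefficient by a phase; by invariance this phase is
    \<open>1\<close> or the coefficient vanishes.\<close>
  have "(\<Sum>k\<le>n. (cis (- \<theta>) ^ m * (cis \<theta> ^ k * cis (- \<theta>) ^ (n - k)) - 1) * a k * hom_monomial n k z) = 0" for z
  proof -
    have "cis (- \<theta>) ^ m * K (z v* v) e = K z e"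
      using inv[OF v, of z e] by (simp add: ev scale cis_cnj)
    then show ?thesis
      unfolding a zv by (simp add: sum_distrib_left algebra_simps sum_subtractf)
  qed
  then have torus: "(cis (- \<theta>) ^ m * (cis \<theta> ^ k * cis (- \<theta>) ^ (n - k)) - 1) * a k = 0" if "k \<le> n" for k
    using that by (rule hom_monomials_independent)
  have a0: "a k = 0" if "k \<le> n" "k < n \<or> n < m" for k
  proof -
    define x where "x = real (n + m - 2 * k) * \<theta>"
    have k: "0 < n + m - 2 * k" "2 * k \<le> n + m" using that \<open>n \<le> m\<close> by auto
    have "cis (- \<theta>) ^ m * (cis \<theta> ^ k * cis (- \<theta>) ^ (n - k)) = cis (- x)"
      using that k by (simp add: Complex.DeMoivre cis_mult x_def of_nat_diff algebra_simps)
    moreover have "cos x \<noteq> 1"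
    proof -
      have "0 < x" using k by (simp add: x_def \<theta>_def)
      moreover have "x \<le> pi"
      proof -
        have "real (n + m - 2 * k) / real (n + m + 1) \<le> 1" by simp
        from mult_left_mono[OF this, of pi] show ?thesis by (simp add: x_def \<theta>_def mult.commute)
      qed
      ultimately show ?thesis using cos_monotone_0_pi[of 0 x] by simp
    qed
    then have "cis (- x) \<noteq> 1" by (auto simp: complex_eq_iff)
    ultimately show ?thesis using torus[OF that(1)] by simp
  qed
  define c where "c = (if n < m then 0 else a n)"
  have Ke: "K z e = c * (z $ 1) ^ n" for z
  proof -
    have "K z e = (\<Sum>k\<in>{n}. a k * hom_monomial n k z)"
      unfolding a using a0 by (intro sum.mono_neutral_right) auto
    then show ?thesis using a0[of n] by (simp add: c_def hom_monomial_def)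
  qed
  have "K z w = c * (z $ 1 * cnj (w $ 1) + z $ 2 * cnj (w $ 2)) ^ n" for z w
  proof (cases "w = 0")
    case True
    then have "w = 0 *s e" by simp
    then have "K z w = 0 ^ m * K z e" using scale[of z 0 e] by simp
    \<comment> \<open>For \<open>m = 0\<close> also \<open>n = 0\<close>, and both sides equal
      \<open>c\<close>; for \<open>m > 0\<close> both vanish, because \<open>n = 0\<close> then
      forces \<open>c = 0\<close>.\<close>
    then show ?thesis using True \<open>n \<le> m\<close> by (cases "m = 0") (auto simp: Ke c_def)
  next
    case False
    define r where "r = sqrt ((norm (w $ 1))\<^sup>2 + (norm (w $ 2))\<^sup>2)"
    have r2: "complex_of_real r * complex_of_real r = w $ 1 * cnj (w $ 1) + w $ 2 * cnj (w $ 2)"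
    proof -
      have "r * r = (norm (w $ 1))\<^sup>2 + (norm (w $ 2))\<^sup>2"
        unfolding r_def by (rule real_sqrt_mult_self[THEN trans]) simp
      then show ?thesis
        by (simp flip: of_real_mult add: complex_norm_square del: of_real_power)
    qed
    have r0: "r \<noteq> 0" using False by (auto simp: r_def Finite_Cartesian_Product.vec_eq_iff forall_2 add_nonneg_eq_0_iff)
    define \<alpha> \<beta> where "\<alpha> = w $ 1 / r" and "\<beta> = w $ 2 / r"
    have unit: "\<alpha> * cnj \<alpha> + \<beta> * cnj \<beta> = 1"
      using r0 by (simp add: \<alpha>_def \<beta>_def add_divide_distrib[symmetric] r2[symmetric])
    define v where "v = su2_matrix \<alpha> \<beta>"
    have v: "v \<in> SU2" unfolding v_def by (rule su2_matrix_in_SU2) (fact unit)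
    have w: "w = of_real r *s (e v* v)"
      using r0 by (simp add: Finite_Cartesian_Product.vec_eq_iff forall_2 vector_matrix_mult_2 e_def v_def \<alpha>_def \<beta>_def)
    \<comment> \<open>\<open>z'\<close> is \<open>z\<close> times the conjugate transpose of
      \<open>v\<close>; multiplied by \<open>r\<close>, its first coordinate is the Hermitian
      product of \<open>z\<close> and \<open>w\<close>.\<close>
    define z' :: "complex^2" where "z' = vector [z $ 1 * cnj \<alpha> + z $ 2 * cnj \<beta>, z $ 2 * \<alpha> - z $ 1 * \<beta>]"
    have "z = z' v* v"
    proof -
      have "z $ 1 = (z $ 1 * cnj \<alpha> + z $ 2 * cnj \<beta>) * \<alpha> - (z $ 2 * \<alpha> - z $ 1 * \<beta>) * cnj \<beta>"
        "z $ 2 = (z $ 1 * cnj \<alpha> + z $ 2 * cnj \<beta>) * \<beta> + (z $ 2 * \<alpha> - z $ 1 * \<beta>) * cnj \<alpha>"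
      proof -
        have "(z $ 1 * cnj \<alpha> + z $ 2 * cnj \<beta>) * \<alpha> - (z $ 2 * \<alpha> - z $ 1 * \<beta>) * cnj \<beta> = z $ 1 * (\<alpha> * cnj \<alpha> + \<beta> * cnj \<beta>)"
          "(z $ 1 * cnj \<alpha> + z $ 2 * cnj \<beta>) * \<beta> + (z $ 2 * \<alpha> - z $ 1 * \<beta>) * cnj \<alpha> = z $ 2 * (\<alpha> * cnj \<alpha> + \<beta> * cnj \<beta>)"
          by (simp_all add: algebra_simps)
        then show "z $ 1 = (z $ 1 * cnj \<alpha> + z $ 2 * cnj \<beta>) * \<alpha> - (z $ 2 * \<alpha> - z $ 1 * \<beta>) * cnj \<beta>"
        "z $ 2 = (z $ 1 * cnj \<alpha> + z $ 2 * cnj \<beta>) * \<beta> + (z $ 2 * \<alpha> - z $ 1 * \<beta>) * cnj \<alpha>"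
          by (simp_all only: unit mult_1_right)
      qed
      then show ?thesis
        by (simp add: Finite_Cartesian_Product.vec_eq_iff forall_2 vector_matrix_mult_2 z'_def v_def)
    qed
    then have "K z w = of_real r ^ m * (c * (z' $ 1) ^ n)"
      using inv[OF v, of z' e] by (subst w) (simp add: scale Ke)
    also have "\<dots> = c * (of_real r * (z $ 1 * cnj \<alpha> + z $ 2 * cnj \<beta>)) ^ n"
      using \<open>n \<le> m\<close> by (cases "n = m") (auto simp: c_def z'_def power_mult_distrib)
    also have "of_real r * (z $ 1 * cnj \<alpha> + z $ 2 * cnj \<beta>) = z $ 1 * cnj (w $ 1) + z $ 2 * cnj (w $ 2)"
      using r0 by (simp add: \<alpha>_def \<beta>_def field_simps)
    finally show ?thesis .
  qed
  then show ?thesis by (intro exI[of _ c]) (auto simp: c_def)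
qed

text \<open>\<open>hom_coeff j k l u\<close> is the coefficient of \<open>z\<^sub>1\<^sup>l z\<^sub>2\<^bsup>j+k-l\<^esup>\<close> in \<open>(z u)\<^sub>1\<^sup>j (z u)\<^sub>2\<^sup>k\<close>, read off
  after dehomogenizing with \<open>z\<^sub>2 = 1\<close>.\<close>

definition hom_coeff :: "nat \<Rightarrow> nat \<Rightarrow> nat \<Rightarrow> complex^2^2 \<Rightarrow> complex" where
  "hom_coeff j k l u = coeff ([:u $ 2 $ 1, u $ 1 $ 1:] ^ j * [:u $ 2 $ 2, u $ 1 $ 2:] ^ k) l"

text \<open>Under dehomogenization, multiplying by a linear form is multiplying by
  \<open>[:c, d:]\<close>. By the degree bound, the part multiplied by \<open>c\<close> involves
  only coefficients up to \<open>n\<close>.\<close>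

lemma hom_monomial_linear_mult:
  assumes "degree p \<le> n"
  shows "(\<Sum>l\<le>Suc n. coeff ([:c, d:] * p) l * hom_monomial (Suc n) l z)
    = (d * z $ 1 + c * z $ 2) * (\<Sum>l\<le>n. coeff p l * hom_monomial n l z)"
proof -
  have "(\<Sum>l\<le>Suc n. coeff ([:c, d:] * p) l * hom_monomial (Suc n) l z)
      = (\<Sum>l\<le>Suc n. c * coeff p l * hom_monomial (Suc n) l z)
      + (\<Sum>l\<le>Suc n. d * coeff (pCons 0 p) l * hom_monomial (Suc n) l z)"
    unfolding sum.distrib[symmetric]
    by (intro sum.cong refl) (auto simp: coeff_pCons algebra_simps split: nat.split)
  also have "(\<Sum>l\<le>Suc n. c * coeff p l * hom_monomial (Suc n) l z)
      = (\<Sum>l\<le>n. c * coeff p l * hom_monomial (Suc n) l z)"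
    using assms by (simp add: coeff_eq_0)
  also have "\<dots> = (\<Sum>l\<le>n. c * z $ 2 * (coeff p l * hom_monomial n l z))"
    by (intro sum.cong) (auto simp: hom_monomial_def Suc_diff_le)
  also have "(\<Sum>l\<le>Suc n. d * coeff (pCons 0 p) l * hom_monomial (Suc n) l z)
      = (\<Sum>l\<le>n. d * z $ 1 * (coeff p l * hom_monomial n l z))"
    by (simp add: sum.atMost_Suc_shift hom_monomial_def mult_ac del: sum.atMost_Suc)
  finally show ?thesis by (simp add: sum_distrib_left algebra_simps sum.distrib)
qed

lemma degree_linear_powers: "degree ([:a, b:] ^ j * [:c, d:] ^ k) \<le> j + k" for a b c d :: complex
proof -
  have "degree ([:a, b:] ^ j) \<le> j" for a b :: complex and j
    by (rule order_trans[OF degree_power_le]) (simp add: degree_pCons_eq_if)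
  then show ?thesis by (meson add_mono degree_mult_le order_trans)
qed

text \<open>Induction adds one linear form at a time. Thus the \<open>hom_coeff\<close> are the
  entries of the representation in the monomial basis.\<close>

lemma hom_monomial_act:
  "hom_monomial (j + k) j (z v* u) = (\<Sum>l\<le>j + k. hom_coeff j k l u * hom_monomial (j + k) l z)"
proof -
  have "(\<Sum>l\<le>j + k. coeff ([:c, d:] ^ j * [:c', d':] ^ k) l * hom_monomial (j + k) l z)
      = (d * z $ 1 + c * z $ 2) ^ j * (d' * z $ 1 + c' * z $ 2) ^ k" for c d c' d'
  proof (induction j)
    case 0
    show ?case
    proof (induction k)
      case 0
      show ?case by (simp add: hom_monomial_def)
    next
      case (Suc k)
      then show ?case
        using hom_monomial_linear_mult[of "[:c', d':] ^ k" k c' d' z] degree_linear_powers[of 1 1 0 c' d' k]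
        by (simp add: mult.assoc del: sum.atMost_Suc mult_pCons_left)
    qed
  next
    case (Suc j)
    then show ?case
      using hom_monomial_linear_mult[of "[:c, d:] ^ j * [:c', d':] ^ k" "j + k" c d z]
        degree_linear_powers[of c d j c' d' k]
      by (simp add: mult.assoc del: sum.atMost_Suc mult_pCons_left)
  qed
  then show ?thesis
    by (simp add: hom_coeff_def hom_monomial_def vector_matrix_mult_2 mult.commute)
qed

lemma hom_coeff_continuous: "continuous_on S (hom_coeff j k l)"
proof -
  have mult: "\<forall>l. continuous_on S (\<lambda>u. coeff (p u * q u) l)"
    if "\<forall>l. continuous_on S (\<lambda>u. coeff (p u) l)" "\<forall>l. continuous_on S (\<lambda>u. coeff (q u) l)"
    for p q :: "complex^2^2 \<Rightarrow> complex poly"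
    using that unfolding coeff_mult by (auto intro!: continuous_intros)
  have linear: "\<forall>l. continuous_on S (\<lambda>u. coeff [:u $ a $ i, u $ b $ i:] l)" for a b i :: 2
  proof -
    have "coeff [:x, y:] l = (if l = 0 then x else if l = 1 then y else 0)" for x y :: complex and l
      by (auto simp: coeff_pCons split: nat.split)
    then show ?thesis
      by (intro allI; case_tac "l = 0"; case_tac "l = 1") (auto intro!: continuous_intros)
  qed
  have power: "\<forall>l. continuous_on S (\<lambda>u. coeff ([:u $ a $ i, u $ b $ i:] ^ j) l)" for a b i :: 2 and j
  proof (induction j)
    case (Suc j)
    show ?case unfolding power_Suc by (rule mult[OF linear Suc])
  qed simp
  show ?thesis unfolding hom_coeff_def by (rule mult[OF power power, THEN spec])
qed

section \<open>Testing against continuous functions\<close>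

text \<open>Distance cutoffs approximate the indicator of a closed set, so integrals of
  \<open>f\<close> over closed sets vanish. Closed sets generate the Borel sets and are stable under
  intersection; hence the measures whose densities are the positive and negative parts of
  \<open>f\<close> agree, and so do these densities.\<close>

lemma AE_eq_0_if_integral_continuous_eq_0_real:
  fixes f :: "'a::metric_space \<Rightarrow> real"
  assumes "finite_measure M" and M: "sets M = sets (restrict_space borel S)" and S [measurable]: "S \<in> sets borel"
    and f: "integrable M f"
    and zero: "\<And>h :: 'a \<Rightarrow> real. continuous_on UNIV h \<Longrightarrow> (\<And>x. 0 \<le> h x \<and> h x \<le> 1) \<Longrightarrow> (LINT x|M. f x * h x) = 0"
  shows "AE x in M. f x = 0"
proof -
  interpret finite_measure M by fact
  have space: "space M = S" using sets_eq_imp_space_eq[OF M] by simp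
  have [measurable]: "f \<in> borel_measurable M" using f by simp
  have id [measurable]: "(\<lambda>x. x) \<in> measurable M borel"
    by (simp add: measurable_cong_sets[OF M refl] measurable_restrict_space1)
  have closed_zero: "(LINT x|M. f x * indicator C x) = 0" if "closed C" for C
  proof (cases "C = {}")
    case False
    \<comment> \<open>The cutoff is \<open>1\<close> on \<open>C\<close>; off the closed set
      \<open>C\<close> the distance is positive, so \<open>h n x\<close> is eventually
      \<open>0\<close>.\<close>
    define h where "h n x = max 0 (1 - real n * infdist x C)" for n x
    have h: "continuous_on UNIV (h n)" "0 \<le> h n x" "h n x \<le> 1" for n x
      unfolding h_def by (auto intro!: continuous_intros simp: infdist_nonneg)
    have [measurable]: "(\<lambda>x. h n x) \<in> borel_measurable M" for n
      using measurable_compose[OF id borel_measurable_continuous_onI[OF h(1)]] .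
    have CM: "C \<inter> space M \<in> sets M"
      using measurable_sets[OF id, of C] that by (simp add: vimage_def Int_def)
    have lim: "(\<lambda>n. h n x) \<longlonglongrightarrow> indicator C x" for x
    proof (cases "x \<in> C")
      case True
      then show ?thesis by (simp add: h_def)
    next
      case out: False
      then have pos: "0 < infdist x C"
        using that False in_closed_iff_infdist_zero[of C x] infdist_nonneg[of x C] by fastforce
      then obtain N where N: "1 < real N * infdist x C" using reals_Archimedean3 by metis
      have "\<forall>\<^sub>F n in sequentially. h n x = 0"
      proof (rule eventually_sequentiallyI[of N])
        fix n assume "N \<le> n"
        then have "real N * infdist x C \<le> real n * infdist x C" using pos by (intro mult_right_mono) auto
        then show "h n x = 0" using N by (simp add: h_def)
      qed
      then show ?thesis using out by (simp add: tendsto_eventually)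
    qed
    have "(\<lambda>n. LINT x|M. f x * h n x) \<longlonglongrightarrow> (LINT x|M. f x * indicator C x)"
    proof (rule integral_dominated_convergence[where w = "\<lambda>x. \<bar>f x\<bar>"])
      show "(\<lambda>x. f x * indicator C x) \<in> borel_measurable M"
        using CM by (intro borel_measurable_times) (simp_all add: borel_measurable_indicator_iff)
      show "AE x in M. (\<lambda>n. f x * h n x) \<longlonglongrightarrow> f x * indicator C x"
        by (intro AE_I2 tendsto_intros lim)
      show "AE x in M. norm (f x * h n x) \<le> \<bar>f x\<bar>" for n
        using h by (intro AE_I2) (simp add: abs_mult mult_left_le)
    qed (use f in auto)
    moreover have "(LINT x|M. f x * h n x) = 0" for n by (rule zero) (use h in auto)
    ultimately show ?thesis by (simp add: LIMSEQ_const_iff)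
  qed simp
  \<comment> \<open>\<open>ennreal\<close> sends negative reals to \<open>0\<close>, so
    \<open>P 1\<close> and \<open>P (-1)\<close> have the positive and the negative part of
    \<open>f\<close> as densities.\<close>
  define P where "P \<sigma> = density M (\<lambda>x. ennreal (\<sigma> * f x))" for \<sigma> :: real
  have integrable_pos: "integrable M (\<lambda>x. max 0 (\<sigma> * f x) * indicator C x)" if "C \<inter> S \<in> sets M" for C \<sigma>
  proof (rule Bochner_Integration.integrable_bound)
    have [measurable]: "(indicator C :: 'a \<Rightarrow> real) \<in> borel_measurable M"
      using that by (simp add: borel_measurable_indicator_iff space)
    show "(\<lambda>x. max 0 (\<sigma> * f x) * indicator C x) \<in> borel_measurable M" by measurable
    show "integrable M (\<lambda>x. \<sigma> * f x)" using f by simp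
    show "AE x in M. norm (max 0 (\<sigma> * f x) * indicator C x) \<le> norm (\<sigma> * f x)"
      by (rule AE_I2) (auto simp: abs_ge_self split: split_indicator)
  qed
  have P_closed: "emeasure (P \<sigma>) (C \<inter> S) = ennreal (LINT x|M. max 0 (\<sigma> * f x) * indicator C x)"
    if "C \<in> sets borel" for C \<sigma>
  proof -
    have C: "C \<inter> S \<in> sets M" using that by (auto simp: M sets_restrict_space)
    then have "emeasure (P \<sigma>) (C \<inter> S) = (\<integral>\<^sup>+x. ennreal (max 0 (\<sigma> * f x) * indicator C x) \<partial>M)"
      unfolding P_def by (subst emeasure_density)
        (auto intro!: nn_integral_cong simp: space max_def ennreal_neg split: split_indicator)
    also have "\<dots> = ennreal (LINT x|M. max 0 (\<sigma> * f x) * indicator C x)"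
      using integrable_pos[OF C] by (rule nn_integral_eq_integral) simp
    finally show ?thesis .
  qed
  \<comment> \<open>The measures are transported from \<open>S\<close> to the whole space, where the
    closed sets generate the sigma-algebra.\<close>
  have "distr (P 1) borel (\<lambda>x. x) = distr (P (-1)) borel (\<lambda>x. x)"
  proof (rule measure_eqI_generator_eq[where E = "{C. closed C}" and \<Omega> = UNIV and A = "\<lambda>_. UNIV"])
    show "Int_stable {C :: 'a set. closed C}" by (auto simp: Int_stable_def)
    have P_distr: "emeasure (distr (P \<sigma>) borel (\<lambda>x. x)) X = emeasure (P \<sigma>) (X \<inter> S)" if "X \<in> sets borel" for X \<sigma>
      using that id by (subst emeasure_distr) (auto simp: P_def space vimage_def Int_def)
    show "emeasure (distr (P 1) borel (\<lambda>x. x)) X = emeasure (distr (P (-1)) borel (\<lambda>x. x)) X"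
      if "X \<in> {C. closed C}" for X
    proof -
      have X: "closed X" "X \<in> sets borel" using that by auto
      have i: "integrable M (\<lambda>x. max 0 (\<sigma> * f x) * indicator X x)" for \<sigma>
        using measurable_sets[OF id X(2)] by (intro integrable_pos) (simp add: space)
      have "(LINT x|M. max 0 (1 * f x) * indicator X x) - (LINT x|M. max 0 (-1 * f x) * indicator X x)
          = (LINT x|M. f x * indicator X x)"
        unfolding Bochner_Integration.integral_diff[OF i i, symmetric]
        by (intro Bochner_Integration.integral_cong refl) (simp add: max_def split: split_indicator)
      then show ?thesis using closed_zero[OF X(1)] by (simp add: P_distr P_closed X)
    qed
    show "emeasure (distr (P 1) borel (\<lambda>x. x)) UNIV \<noteq> \<infinity>" using P_closed[of UNIV 1] by (simp add: P_distr)
  qed (auto simp: borel_eq_closed)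
  then have eq: "emeasure (P 1) (X \<inter> S) = emeasure (P (-1)) (X \<inter> S)" if "X \<in> sets borel" for X
  proof -
    have "emeasure (distr (P \<sigma>) borel (\<lambda>x. x)) X = emeasure (P \<sigma>) (X \<inter> S)" for \<sigma>
      using that id by (subst emeasure_distr) (auto simp: P_def space vimage_def Int_def)
    then show ?thesis using \<open>distr (P 1) borel (\<lambda>x. x) = _\<close> by metis
  qed
  have "AE x in M. ennreal (1 * f x) = ennreal (-1 * f x)"
  proof (rule density_unique_finite_measure)
    fix A assume A: "A \<in> sets M"
    then obtain X where X: "X \<in> sets borel" "A = X \<inter> S" by (auto simp: M sets_restrict_space)
    show "(\<integral>\<^sup>+x. ennreal (1 * f x) * indicator A x \<partial>M) = (\<integral>\<^sup>+x. ennreal (-1 * f x) * indicator A x \<partial>M)"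
      using eq[OF X(1)] A unfolding P_def X(2) by (subst (asm) (1 2) emeasure_density) auto
  qed auto
  then show ?thesis
  proof eventually_elim
    case (elim x)
    \<comment> \<open>At most one of the two parts is nonzero at a point, so their equality forces
      both to vanish.\<close>
    then show ?case
      by (cases "f x \<ge> 0") (auto simp: ennreal_neg ennreal_eq_0_iff)
  qed
qed

lemma AE_eq_0_if_integral_continuous_eq_0:
  fixes f :: "'a::metric_space \<Rightarrow> complex"
  assumes "finite_measure M" and M: "sets M = sets (restrict_space borel S)" and S: "S \<in> sets borel"
    and f: "integrable M f"
    and zero: "\<And>h :: 'a \<Rightarrow> real. continuous_on UNIV h \<Longrightarrow> (\<And>x. 0 \<le> h x \<and> h x \<le> 1) \<Longrightarrow>
      (LINT x|M. f x * complex_of_real (h x)) = 0"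
  shows "AE x in M. f x = 0"
proof -
  have int: "integrable M (\<lambda>x. f x * complex_of_real (h x))"
    if h: "continuous_on UNIV h" "\<And>x. 0 \<le> h x \<and> h x \<le> 1" for h :: "'a \<Rightarrow> real"
  proof (rule integrable_mult_bounded[OF f])
    have "(\<lambda>x. x) \<in> measurable M borel"
      by (simp add: measurable_cong_sets[OF M refl] measurable_restrict_space1)
    from measurable_compose[OF this borel_measurable_continuous_onI[OF h(1)]]
    show "(\<lambda>x. complex_of_real (h x)) \<in> borel_measurable M" by simp
    show "norm (complex_of_real (h x)) \<le> 1" for x using h(2)[of x] by simp
  qed
  have "AE x in M. Re (f x) = 0"
  proof (rule AE_eq_0_if_integral_continuous_eq_0_real[OF assms(1) M S])
    show "(LINT x|M. Re (f x) * h x) = 0"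
      if h: "continuous_on UNIV h" "\<And>x. 0 \<le> h x \<and> h x \<le> 1" for h :: "'a \<Rightarrow> real"
      using integral_Re[OF int[OF h]] zero[OF h] by simp
  qed (use f in simp)
  moreover have "AE x in M. Im (f x) = 0"
  proof (rule AE_eq_0_if_integral_continuous_eq_0_real[OF assms(1) M S])
    show "(LINT x|M. Im (f x) * h x) = 0"
      if h: "continuous_on UNIV h" "\<And>x. 0 \<le> h x \<and> h x \<le> 1" for h :: "'a \<Rightarrow> real"
      using integral_Im[OF int[OF h]] zero[OF h] by simp
  qed (use f in simp)
  ultimately show ?thesis by eventually_elim (simp add: complex_eq_iff)
qed

section \<open>The algebra of matrix coefficients\<close>

text \<open>The rule \<open>cong\<close> identifies functions that agree on \<open>SU2\<close>,
  since relations such as the determinant condition are available only there.\<close>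

inductive matrix_coeff_span :: "(complex^2^2 \<Rightarrow> complex) \<Rightarrow> bool" where
  coeff: "matrix_coeff_span (hom_coeff j k l)"
| add: "matrix_coeff_span f \<Longrightarrow> matrix_coeff_span g \<Longrightarrow> matrix_coeff_span (\<lambda>u. f u + g u)"
| scale: "matrix_coeff_span f \<Longrightarrow> matrix_coeff_span (\<lambda>u. c * f u)"
| cong: "matrix_coeff_span f \<Longrightarrow> (\<And>u. u \<in> SU2 \<Longrightarrow> f u = g u) \<Longrightarrow> matrix_coeff_span g"

lemma matrix_coeff_span_diff:
  assumes "matrix_coeff_span f" "matrix_coeff_span g"
  shows "matrix_coeff_span (\<lambda>u. f u - g u)"
  using matrix_coeff_span.add[OF assms(1) matrix_coeff_span.scale[OF assms(2), of "-1"]] by simp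

lemma pderiv_power_Suc':
  fixes p :: "complex poly"
  shows "pderiv (p ^ Suc n) = of_nat (Suc n) * p ^ n * pderiv p"
  by (simp only: pderiv_power_Suc of_nat_poly) (simp del: of_nat_Suc)

text \<open>Contiguity relations for \<open>P\<^sup>j Q\<^sup>k\<close> with \<open>P = u\<^sub>2\<^sub>1 + u\<^sub>1\<^sub>1 X\<close>, \<open>Q = u\<^sub>2\<^sub>2 + u\<^sub>1\<^sub>2 X\<close>: the product rule
  combined with \<open>u\<^sub>1\<^sub>1 Q - u\<^sub>1\<^sub>2 P = det u = 1\<close>.\<close>

lemma hom_coeff_mult_11:
  assumes "u \<in> SU2"
  shows "of_nat (j + k + 1) * (u $ 1 $ 1 * hom_coeff j k l u)
    = of_nat (l + 1) * hom_coeff (Suc j) k (Suc l) u + of_nat k * hom_coeff j (k - 1) l u"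
proof -
  define P Q where "P = [:u $ 2 $ 1, u $ 1 $ 1:]" and "Q = [:u $ 2 $ 2, u $ 1 $ 2:]"
  have PQ: "[:u $ 1 $ 1:] * Q - [:u $ 1 $ 2:] * P = 1"
    using SU2_det[OF assms] by (simp add: P_def Q_def one_pCons mult.commute)
  have dP: "pderiv P = [:u $ 1 $ 1:]" and dQ: "pderiv Q = [:u $ 1 $ 2:]"
    by (simp_all add: P_def Q_def pderiv_pCons)
  have "of_nat (j + k + 1) * ([:u $ 1 $ 1:] * (P ^ j * Q ^ k))
      = pderiv (P ^ Suc j * Q ^ k) + of_nat k * (P ^ j * Q ^ (k - 1))"
  proof (cases k)
    \<comment> \<open>For \<open>k = 0\<close> the truncated exponent \<open>k - 1\<close> is
      harmless: its term carries the factor \<open>of_nat k\<close>.\<close>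
    case 0
    have "pderiv (P ^ Suc j * Q ^ 0) = Polynomial.smult (of_nat (Suc j)) (P ^ j) * [:u $ 1 $ 1:]"
      by (simp only: power_0 mult_1_right pderiv_power_Suc dP)
    with 0 show ?thesis by (simp add: of_nat_poly mult.commute del: power_Suc)
  next
    case (Suc k')
    have "pderiv (P ^ Suc j * Q ^ Suc k')
        = P ^ Suc j * (of_nat (Suc k') * Q ^ k' * [:u $ 1 $ 2:]) + Q ^ Suc k' * (of_nat (Suc j) * P ^ j * [:u $ 1 $ 1:])"
      by (simp only: pderiv_mult pderiv_power_Suc' dP dQ)
    also have "\<dots> = of_nat (j + Suc k' + 1) * ([:u $ 1 $ 1:] * (P ^ j * Q ^ Suc k'))
        - of_nat (Suc k') * (P ^ j * Q ^ k') * ([:u $ 1 $ 1:] * Q - [:u $ 1 $ 2:] * P)"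
      by (simp only: power_Suc of_nat_add of_nat_Suc of_nat_1 ring_distribs mult_ac add_ac diff_conv_add_uminus mult_minus_left mult_minus_right minus_add_distrib minus_minus) simp
    finally show ?thesis unfolding PQ by (simp add: Suc)
  qed
  \<comment> \<open>Differentiation shifts coefficients, whence the index \<open>Suc l\<close> and
    the factor \<open>l + 1\<close>.\<close>
  from arg_cong[OF this, of "\<lambda>p. coeff p l"] show ?thesis
    by (simp add: hom_coeff_def P_def Q_def coeff_pderiv of_nat_poly algebra_simps del: power_Suc)
qed

lemma hom_coeff_mult_12:
  assumes "u \<in> SU2"
  shows "of_nat (j + k + 1) * (u $ 1 $ 2 * hom_coeff j k l u)
    = of_nat (l + 1) * hom_coeff j (Suc k) (Suc l) u - of_nat j * hom_coeff (j - 1) k l u"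
proof -
  define P Q where "P = [:u $ 2 $ 1, u $ 1 $ 1:]" and "Q = [:u $ 2 $ 2, u $ 1 $ 2:]"
  have PQ: "[:u $ 1 $ 1:] * Q - [:u $ 1 $ 2:] * P = 1"
    using SU2_det[OF assms] by (simp add: P_def Q_def one_pCons mult.commute)
  have dP: "pderiv P = [:u $ 1 $ 1:]" and dQ: "pderiv Q = [:u $ 1 $ 2:]"
    by (simp_all add: P_def Q_def pderiv_pCons)
  have "of_nat (j + k + 1) * ([:u $ 1 $ 2:] * (P ^ j * Q ^ k))
      = pderiv (P ^ j * Q ^ Suc k) - of_nat j * (P ^ (j - 1) * Q ^ k)"
  proof (cases j)
    case 0
    have "pderiv (P ^ 0 * Q ^ Suc k) = Polynomial.smult (of_nat (Suc k)) (Q ^ k) * [:u $ 1 $ 2:]"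
      by (simp only: power_0 mult_1_left pderiv_power_Suc dQ)
    with 0 show ?thesis by (simp add: of_nat_poly mult.commute del: power_Suc)
  next
    case (Suc j')
    have "pderiv (P ^ Suc j' * Q ^ Suc k)
        = P ^ Suc j' * (of_nat (Suc k) * Q ^ k * [:u $ 1 $ 2:]) + Q ^ Suc k * (of_nat (Suc j') * P ^ j' * [:u $ 1 $ 1:])"
      by (simp only: pderiv_mult pderiv_power_Suc' dP dQ)
    also have "\<dots> = of_nat (Suc j' + k + 1) * ([:u $ 1 $ 2:] * (P ^ Suc j' * Q ^ k))
        + of_nat (Suc j') * (P ^ j' * Q ^ k) * ([:u $ 1 $ 1:] * Q - [:u $ 1 $ 2:] * P)"
      by (simp only: power_Suc of_nat_add of_nat_Suc of_nat_1 ring_distribs mult_ac add_ac diff_conv_add_uminus mult_minus_left mult_minus_right minus_add_distrib minus_minus) simp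
    finally show ?thesis unfolding PQ by (simp add: Suc)
  qed
  from arg_cong[OF this, of "\<lambda>p. coeff p l"] show ?thesis
    by (simp add: hom_coeff_def P_def Q_def coeff_pderiv of_nat_poly algebra_simps del: power_Suc)
qed

text \<open>One linear factor is split off. Solved for the products with \<open>u $ 2 $ 1\<close>
  and \<open>u $ 2 $ 2\<close>, these relations reduce the second row to the first. The guard
  \<open>l = 0\<close> accounts for the absent coefficient below degree zero.\<close>

lemma hom_coeff_Suc:
  "hom_coeff (Suc j) k l u = u $ 2 $ 1 * hom_coeff j k l u + u $ 1 $ 1 * (if l = 0 then 0 else hom_coeff j k (l - 1) u)"
  "hom_coeff j (Suc k) l u = u $ 2 $ 2 * hom_coeff j k l u + u $ 1 $ 2 * (if l = 0 then 0 else hom_coeff j k (l - 1) u)"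
proof -
  have linear: "coeff ([:c, d:] * p) l = c * coeff p l + d * (if l = 0 then 0 else coeff p (l - 1))" for c d and p :: "complex poly"
    by (simp add: coeff_pCons split: nat.split)
  show "hom_coeff (Suc j) k l u = u $ 2 $ 1 * hom_coeff j k l u + u $ 1 $ 1 * (if l = 0 then 0 else hom_coeff j k (l - 1) u)"
    unfolding hom_coeff_def power_Suc mult.assoc by (simp only: linear)
  show "hom_coeff j (Suc k) l u = u $ 2 $ 2 * hom_coeff j k l u + u $ 1 $ 2 * (if l = 0 then 0 else hom_coeff j k (l - 1) u)"
    unfolding hom_coeff_def power_Suc mult.left_commute[of "_ ^ j"] by (simp only: linear)
qed

text \<open>On a generator, the first row is handled by the contiguity relations, divided by the
  nonzero number \<open>j + k + 1\<close>, and the second row by \<open>hom_coeff_Suc\<close>.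
  Closure under multiplication by entries is what brings every polynomial in them into the
  span.\<close>

lemma matrix_coeff_span_entry_mult:
  assumes "matrix_coeff_span g"
  shows "matrix_coeff_span (\<lambda>u. u $ a $ i * g u)"
  using assms
proof (induction g)
  case (coeff j k l)
  have row1: "matrix_coeff_span (\<lambda>u. u $ 1 $ i * hom_coeff j k l u)" for j k l i
  proof -
    have 1: "matrix_coeff_span (\<lambda>u. u $ 1 $ 1 * hom_coeff j k l u)"
    proof (rule matrix_coeff_span.cong)
      show "matrix_coeff_span (\<lambda>u. (1 / of_nat (j + k + 1)) *
          (of_nat (l + 1) * hom_coeff (Suc j) k (Suc l) u + of_nat k * hom_coeff j (k - 1) l u))"
        by (intro matrix_coeff_span.intros)
      show "(1 / of_nat (j + k + 1)) * (of_nat (l + 1) * hom_coeff (Suc j) k (Suc l) u + of_nat k * hom_coeff j (k - 1) l u)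
          = u $ 1 $ 1 * hom_coeff j k l u" if "u \<in> SU2" for u
        unfolding hom_coeff_mult_11[OF that, symmetric] by (simp del: of_nat_Suc of_nat_add)
    qed
    have 2: "matrix_coeff_span (\<lambda>u. u $ 1 $ 2 * hom_coeff j k l u)"
    proof (rule matrix_coeff_span.cong)
      show "matrix_coeff_span (\<lambda>u. (1 / of_nat (j + k + 1)) *
          (of_nat (l + 1) * hom_coeff j (Suc k) (Suc l) u - of_nat j * hom_coeff (j - 1) k l u))"
        by (intro matrix_coeff_span.scale matrix_coeff_span.coeff matrix_coeff_span_diff)
      show "(1 / of_nat (j + k + 1)) * (of_nat (l + 1) * hom_coeff j (Suc k) (Suc l) u - of_nat j * hom_coeff (j - 1) k l u)
          = u $ 1 $ 2 * hom_coeff j k l u" if "u \<in> SU2" for u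
        unfolding hom_coeff_mult_12[OF that, symmetric] by (simp del: of_nat_Suc of_nat_add)
    qed
    show ?thesis using 1 2 exhaust_2[of i] by auto
  qed
  have zero: "matrix_coeff_span (\<lambda>u. u $ 1 $ i * (if l = 0 then 0 else hom_coeff j k (l - 1) u))" for i
    using matrix_coeff_span.scale[OF matrix_coeff_span.coeff[of 0 0 0], of 0] row1
    by (cases "l = 0") simp_all
  have 1: "matrix_coeff_span (\<lambda>u. u $ 2 $ 1 * hom_coeff j k l u)"
    using matrix_coeff_span_diff[OF matrix_coeff_span.coeff[of "Suc j" k l] zero[of 1]]
    by (simp add: hom_coeff_Suc(1))
  have 2: "matrix_coeff_span (\<lambda>u. u $ 2 $ 2 * hom_coeff j k l u)"
    using matrix_coeff_span_diff[OF matrix_coeff_span.coeff[of j "Suc k" l] zero[of 2]]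
    by (simp add: hom_coeff_Suc(2))
  show ?case using row1 1 2 exhaust_2[of a] exhaust_2[of i] by auto
next
  case (add f g)
  then show ?case using matrix_coeff_span.add[OF add.IH] by (simp add: algebra_simps)
next
  case (scale f c)
  then show ?case using matrix_coeff_span.scale[OF scale.IH, of c] by (simp add: mult.left_commute)
next
  case (cong f g)
  show ?case by (rule matrix_coeff_span.cong[OF cong.IH]) (simp add: cong.hyps)
qed

text \<open>Conjugation permutes the entries up to sign, so multiplication by real and imaginary
  parts of entries also preserves the span.\<close>

lemma SU2_cnj_entry:
  "\<exists>a' i' c. \<forall>u\<in>SU2. cnj (u $ a $ i) = c * u $ a' $ i'"
proof -
  have "\<forall>u\<in>SU2. cnj (u $ 1 $ 1) = 1 * u $ 2 $ 2" "\<forall>u\<in>SU2. cnj (u $ 1 $ 2) = - 1 * u $ 2 $ 1"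
    "\<forall>u\<in>SU2. cnj (u $ 2 $ 1) = - 1 * u $ 1 $ 2" "\<forall>u\<in>SU2. cnj (u $ 2 $ 2) = 1 * u $ 1 $ 1"
    by (auto simp: SU2_iff)
  then show ?thesis using exhaust_2[of a] exhaust_2[of i] by metis
qed

lemma matrix_coeff_span_sum:
  assumes "\<And>i. i \<in> I \<Longrightarrow> matrix_coeff_span (f i)"
  shows "matrix_coeff_span (\<lambda>u. \<Sum>i\<in>I. f i u)"
proof -
  have zero: "matrix_coeff_span (\<lambda>u. 0)"
    using matrix_coeff_span.scale[OF matrix_coeff_span.coeff[of 0 0 0], of 0] by simp
  show ?thesis
    using assms by (induction I rule: infinite_finite_induct) (auto intro: zero matrix_coeff_span.add)
qed

text \<open>Real polynomial functions are built from real linear functionals, which are combinations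
  of real and imaginary parts of entries. The factor \<open>g\<close> is kept arbitrary because a
  product \<open>p * q\<close> is treated by multiplying with \<open>q\<close> first and then with
  \<open>p\<close>.\<close>

lemma matrix_coeff_span_polynomial_mult:
  assumes "real_polynomial_function q" "matrix_coeff_span g"
  shows "matrix_coeff_span (\<lambda>u. complex_of_real (q u) * g u)"
  using assms
proof (induction q arbitrary: g rule: real_polynomial_function.induct)
  case (linear q)
  interpret q: bounded_linear q by fact
  have Re: "matrix_coeff_span (\<lambda>u. complex_of_real (Re (u $ a $ i)) * g u)"
    and Im: "matrix_coeff_span (\<lambda>u. complex_of_real (Im (u $ a $ i)) * g u)" for a i
  proof -
    obtain a' i' c where c: "\<And>u. u \<in> SU2 \<Longrightarrow> cnj (u $ a $ i) = c * u $ a' $ i'"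
      using SU2_cnj_entry[of a i] by blast
    note 1 = matrix_coeff_span_entry_mult[OF linear.prems, of a i]
      and 2 = matrix_coeff_span.scale[OF matrix_coeff_span_entry_mult[OF linear.prems, of a' i'], of c]
    show "matrix_coeff_span (\<lambda>u. complex_of_real (Re (u $ a $ i)) * g u)"
    proof (rule matrix_coeff_span.cong[OF matrix_coeff_span.scale[OF matrix_coeff_span.add[OF 1 2], of "1 / 2"]])
      fix u assume "u \<in> SU2"
      have "1 / 2 * (u $ a $ i * g u + c * (u $ a' $ i' * g u)) = (u $ a $ i + cnj (u $ a $ i)) / 2 * g u"
        using c[OF \<open>u \<in> SU2\<close>] by (simp add: algebra_simps)
      then show "1 / 2 * (u $ a $ i * g u + c * (u $ a' $ i' * g u)) = complex_of_real (Re (u $ a $ i)) * g u"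
        by (simp add: complex_add_cnj)
    qed
    show "matrix_coeff_span (\<lambda>u. complex_of_real (Im (u $ a $ i)) * g u)"
    proof (rule matrix_coeff_span.cong[OF matrix_coeff_span.scale[OF matrix_coeff_span_diff[OF 1 2], of "1 / (2 * \<i>)"]])
      fix u assume "u \<in> SU2"
      have "1 / (2 * \<i>) * (u $ a $ i * g u - c * (u $ a' $ i' * g u)) = (u $ a $ i - cnj (u $ a $ i)) / (2 * \<i>) * g u"
        using c[OF \<open>u \<in> SU2\<close>] by (simp add: algebra_simps diff_divide_distrib)
      also have "(u $ a $ i - cnj (u $ a $ i)) / (2 * \<i>) = complex_of_real (Im (u $ a $ i))"
        by (subst divide_eq_eq) (simp add: complex_eq_iff)
      finally show "1 / (2 * \<i>) * (u $ a $ i * g u - c * (u $ a' $ i' * g u)) = complex_of_real (Im (u $ a $ i)) * g u" .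
    qed
  qed
  have q: "q u = (\<Sum>a\<in>UNIV. \<Sum>i\<in>UNIV. Re (u $ a $ i) * q (axis a (axis i 1)) + Im (u $ a $ i) * q (axis a (axis i \<i>)))" for u
  proof -
    have "u = (\<Sum>a\<in>UNIV. \<Sum>i\<in>UNIV. Re (u $ a $ i) *\<^sub>R axis a (axis i 1) + Im (u $ a $ i) *\<^sub>R axis a (axis i \<i>))"
      by (simp add: Finite_Cartesian_Product.vec_eq_iff axis_def sum_2 forall_2 complex_eq_iff)
    from arg_cong[OF this, of q] show ?thesis
      by (simp only: linear_sum[OF q.linear] linear_add[OF q.linear] linear_cmul[OF q.linear] real_scaleR_def)
  qed
  have "matrix_coeff_span (\<lambda>u. \<Sum>a\<in>UNIV. \<Sum>i\<in>UNIV. complex_of_real (q (axis a (axis i 1))) * (complex_of_real (Re (u $ a $ i)) * g u)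
      + complex_of_real (q (axis a (axis i \<i>))) * (complex_of_real (Im (u $ a $ i)) * g u))"
    by (intro matrix_coeff_span_sum matrix_coeff_span.add matrix_coeff_span.scale Re Im)
  then show ?case
    by (subst q) (simp add: sum_2 algebra_simps)
next
  case (const c)
  then show ?case by (rule matrix_coeff_span.scale)
next
  case (add p q)
  then show ?case using matrix_coeff_span.add[OF add.IH(1)[OF add.prems] add.IH(2)[OF add.prems]]
    by (simp add: algebra_simps)
next
  case (mult p q)
  then show ?case using mult.IH(1)[OF mult.IH(2)[OF mult.prems]] by (simp add: mult.assoc)
qed

section \<open>Schur orthogonality and Fourier series\<close>

lemma sum_lessThan_add_1: "sum f {..<n + 1} = sum f {..n}" for n :: nat
  by (simp add: lessThan_Suc_atMost)

lemma index_mult_mat_sum: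
  assumes "A \<in> carrier_mat (n + 1) (n + 1)" "B \<in> carrier_mat (n + 1) (n + 1)" "i \<le> n" "j \<le> n"
  shows "(A * B) $$ (i, j) = (\<Sum>k\<le>n. A $$ (i, k) * B $$ (k, j))"
  using assms by (simp add: scalar_prod_def atLeast0LessThan lessThan_Suc_atMost del: sum.lessThan_Suc sum.atMost_Suc)

lemma mat_adjoint_carrier:
  "A \<in> carrier_mat n n \<Longrightarrow> mat_adjoint A \<in> carrier_mat n n"
  by (auto simp: mat_adjoint_def)

lemma mat_adjoint_index:
  fixes A :: "complex mat"
  assumes "A \<in> carrier_mat n n" "i < n" "j < n"
  shows "mat_adjoint A $$ (i, j) = cnj (A $$ (j, i))"
  using assms by (simp add: mat_adjoint_def mat_of_rows_index)

lemma ex1_implies_unique: "\<exists>!x. P x \<Longrightarrow> P x \<Longrightarrow> P y \<Longrightarrow> x = y"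
  by blast

text \<open>The bases hidden in the existential quantifier of \<open>unitary_rep_SU2\<close> become
  the parameter \<open>B\<close>, linking the matrices to polynomials.\<close>

locale unitary_reps =
  fixes \<mu> :: "(complex^2^2) measure" and t :: "nat \<Rightarrow> complex^2^2 \<Rightarrow> complex mat"
    and B :: "nat \<Rightarrow> nat \<Rightarrow> complex^2 \<Rightarrow> complex"
  assumes haar: "normalized_haar_SU2 \<mu>"
    and basis: "\<And>n. is_basis_hom_polys n (B n)"
    and unitary: "\<And>n u. u \<in> SU2 \<Longrightarrow> unitary_mat (n + 1) (t n u)"
    and act: "\<And>n u j z. u \<in> SU2 \<Longrightarrow> j < n + 1 \<Longrightarrow>
      SU2_act u (B n j) z = (\<Sum>i<n + 1. t n u $$ (i, j) * B n i z)"
begin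

section \<open>Integration over the group\<close>

lemma sets_mu: "sets \<mu> = sets (restrict_space borel SU2)"
  using haar by (simp add: normalized_haar_SU2_def)

lemma space_mu: "space \<mu> = SU2"
  using sets_eq_imp_space_eq[OF sets_mu] by simp

sublocale prob_space \<mu>
  using haar by (simp add: normalized_haar_SU2_def)

lemma measurable_continuous_on_SU2:
  "continuous_on SU2 h \<Longrightarrow> h \<in> borel_measurable \<mu>" for h :: "complex^2^2 \<Rightarrow> 'b::topological_space"
  by (simp add: measurable_cong_sets[OF sets_mu refl] borel_measurable_continuous_on_restrict)

lemma continuous_on_SU2_bounded:
  fixes h :: "complex^2^2 \<Rightarrow> 'b::real_normed_vector"
  assumes "continuous_on SU2 h"
  obtains K where "\<And>u. u \<in> SU2 \<Longrightarrow> norm (h u) \<le> K"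
  using compact_imp_bounded[OF compact_continuous_image[OF assms compact_SU2]]
  unfolding bounded_iff by blast

lemma integrable_continuous_on_SU2:
  fixes h :: "complex^2^2 \<Rightarrow> 'b::{banach, second_countable_topology}"
  assumes "continuous_on SU2 h"
  shows "integrable \<mu> h"
proof -
  obtain K where "\<And>u. u \<in> SU2 \<Longrightarrow> norm (h u) \<le> K"
    using continuous_on_SU2_bounded[OF assms] by blast
  then show ?thesis
    using measurable_continuous_on_SU2[OF assms] by (intro integrable_norm_bounded) (simp_all add: space_mu)
qed

lemma integrable_mult_continuous_on_SU2:
  fixes f h :: "complex^2^2 \<Rightarrow> complex"
  assumes f: "integrable \<mu> f" and h: "continuous_on SU2 h"
  shows "integrable \<mu> (\<lambda>u. f u * h u)"
proof -
  obtain K where "\<And>u. u \<in> SU2 \<Longrightarrow> norm (h u) \<le> K"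
    using continuous_on_SU2_bounded[OF h] by blast
  then show ?thesis
    using f measurable_continuous_on_SU2[OF h] by (intro integrable_mult_bounded) (simp_all add: space_mu)
qed

lemma integral_left_invariant:
  fixes h :: "complex^2^2 \<Rightarrow> complex"
  assumes "v \<in> SU2" "continuous_on SU2 h"
  shows "(LINT u|\<mu>. h (v ** u)) = (LINT u|\<mu>. h u)"
proof -
  have "continuous_on SU2 (\<lambda>u. v ** u)"
    unfolding matrix_matrix_mult_def by (intro continuous_intros)
  then have "(\<lambda>u. v ** u) \<in> measurable \<mu> borel" by (rule measurable_continuous_on_SU2)
  then have meas: "(\<lambda>u. v ** u) \<in> measurable \<mu> \<mu>"
    using SU2_mult[OF assms(1)]
    by (auto simp: measurable_cong_sets[OF refl sets_mu] space_mu intro!: measurable_restrict_space2)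
  have "(LINT u|\<mu>. h u) = (LINT u|distr \<mu> \<mu> (\<lambda>u. v ** u). h u)"
    using haar assms(1) by (simp add: normalized_haar_SU2_def)
  also have "\<dots> = (LINT u|\<mu>. h (v ** u))"
    by (rule integral_distr[OF meas measurable_continuous_on_SU2[OF assms(2)]])
  finally show ?thesis by simp
qed

section \<open>Matrix entries of the representations\<close>

definition D :: "nat \<Rightarrow> complex^2^2 \<Rightarrow> nat \<Rightarrow> nat \<Rightarrow> complex" where
  "D n u i j = t n u $$ (i, j)"

lemma act_sum: "u \<in> SU2 \<Longrightarrow> j \<le> n \<Longrightarrow> B n j (z v* u) = (\<Sum>i\<le>n. D n u i j * B n i z)"
  using act[of u j n z] unfolding sum_lessThan_add_1 by (simp add: SU2_act_def D_def)

text \<open>The definition of \<open>unitary_mat\<close> gives orthonormal rows; for columns, a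
  right inverse of a square matrix is also a left inverse.\<close>

lemma D_unitary:
  assumes "u \<in> SU2" "i \<le> n" "j \<le> n"
  shows "(\<Sum>k\<le>n. D n u i k * cnj (D n u j k)) = of_bool (i = j)"
    and "(\<Sum>k\<le>n. cnj (D n u k i) * D n u k j) = of_bool (i = j)"
proof -
  have c: "t n u \<in> carrier_mat (n + 1) (n + 1)" and eq: "t n u * mat_adjoint (t n u) = 1\<^sub>m (n + 1)"
    using unitary[OF assms(1), of n] by (auto simp: unitary_mat_def)
  note c' = mat_adjoint_carrier[OF c]
  have eq': "mat_adjoint (t n u) * t n u = 1\<^sub>m (n + 1)"
    by (rule mat_mult_left_right_inverse[OF c c' eq])
  have "(\<Sum>k\<le>n. D n u i k * cnj (D n u j k)) = (\<Sum>k\<le>n. t n u $$ (i, k) * mat_adjoint (t n u) $$ (k, j))"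
    using assms by (intro sum.cong refl) (simp add: D_def mat_adjoint_index[OF c])
  also have "\<dots> = of_bool (i = j)"
    using assms by (simp add: index_mult_mat_sum[OF c c', symmetric] eq)
  finally show "(\<Sum>k\<le>n. D n u i k * cnj (D n u j k)) = of_bool (i = j)" .
  have "(\<Sum>k\<le>n. cnj (D n u k i) * D n u k j) = (\<Sum>k\<le>n. mat_adjoint (t n u) $$ (i, k) * t n u $$ (k, j))"
    using assms by (intro sum.cong refl) (simp add: D_def mat_adjoint_index[OF c])
  also have "\<dots> = of_bool (i = j)"
    using assms by (simp add: index_mult_mat_sum[OF c' c, symmetric] eq')
  finally show "(\<Sum>k\<le>n. cnj (D n u k i) * D n u k j) = of_bool (i = j)" .
qed

lemma B_hom: "i \<le> n \<Longrightarrow> B n i \<in> hom_polys n"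
  using basis[of n] by (simp add: is_basis_hom_polys_def)

lemmas B_coordinates = basis[unfolded is_basis_hom_polys_def, THEN conjunct2, THEN bspec]

lemma B_span:
  assumes "P \<in> hom_polys n"
  shows "\<exists>c. \<forall>z. P z = (\<Sum>i\<le>n. c i * B n i z)"
proof -
  obtain a where "\<forall>z. P z = (\<Sum>i<n + 1. vec_index a i * B n i z)"
    using ex1_implies_ex[OF B_coordinates[OF assms]] by blast
  then show ?thesis unfolding sum_lessThan_add_1 by blast
qed

lemma B_independent:
  assumes zero: "\<And>z. (\<Sum>i\<le>n. c i * B n i z) = 0" and "i \<le> n"
  shows "c i = 0"
proof -
  have zero_hom: "(\<lambda>z. 0) \<in> hom_polys n" using hom_polys_sum[of "{}"] by simp
  have "\<forall>z. 0 = (\<Sum>i<n + 1. vec_index (Matrix.vec (n + 1) c) i * B n i z)"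
  proof
    fix z
    have "(\<Sum>i<n + 1. vec_index (Matrix.vec (n + 1) c) i * B n i z) = (\<Sum>i<n + 1. c i * B n i z)"
      by (intro sum.cong) auto
    then show "0 = (\<Sum>i<n + 1. vec_index (Matrix.vec (n + 1) c) i * B n i z)"
      unfolding sum_lessThan_add_1 by (simp add: zero)
  qed
  moreover have "\<forall>z. 0 = (\<Sum>i<n + 1. vec_index (0\<^sub>v (n + 1)) i * B n i z)"
    by (auto intro!: sum.neutral[symmetric] simp del: sum.lessThan_Suc)
  ultimately have "Matrix.vec (n + 1) c = 0\<^sub>v (n + 1)"
    by (intro ex1_implies_unique[OF B_coordinates[OF zero_hom]] conjI vec_carrier zero_carrier_vec)
  from arg_cong[OF this, of "\<lambda>v. vec_index v i"] show ?thesis using assms(2) by simp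
qed

lemma change_of_basis:
  obtains \<alpha> \<beta> where
    "\<And>k z. k \<le> n \<Longrightarrow> hom_monomial n k z = (\<Sum>i\<le>n. \<alpha> k i * B n i z)"
    "\<And>i z. i \<le> n \<Longrightarrow> B n i z = (\<Sum>k\<le>n. \<beta> i k * hom_monomial n k z)"
proof -
  have "\<forall>k. \<exists>c. k \<le> n \<longrightarrow> (\<forall>z. hom_monomial n k z = (\<Sum>i\<le>n. c i * B n i z))"
    using B_span[OF hom_monomial_in_hom_polys] by blast
  then obtain \<alpha> where \<alpha>: "\<And>k z. k \<le> n \<Longrightarrow> hom_monomial n k z = (\<Sum>i\<le>n. \<alpha> k i * B n i z)"
    by metis
  have "\<forall>i. \<exists>c. i \<le> n \<longrightarrow> (\<forall>z. B n i z = (\<Sum>k\<le>n. c k * hom_monomial n k z))"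
    using B_hom unfolding hom_polys_iff by blast
  then obtain \<beta> where \<beta>: "\<And>i z. i \<le> n \<Longrightarrow> B n i z = (\<Sum>k\<le>n. \<beta> i k * hom_monomial n k z)"
    by metis
  show ?thesis by (rule that[OF \<alpha> \<beta>])
qed

lemma hom_monomial_act_le:
  "k \<le> n \<Longrightarrow> hom_monomial n k (z v* u) = (\<Sum>l\<le>n. hom_coeff k (n - k) l u * hom_monomial n l z)"
  using hom_monomial_act[of k "n - k" z u] by simp

text \<open>Passing to monomials and back writes each entry as a fixed linear combination of the
  continuous functions \<open>hom_coeff\<close>, by uniqueness of coordinates.\<close>

lemma D_continuous:
  assumes "i \<le> n" "j \<le> n"
  shows "continuous_on SU2 (\<lambda>u. D n u i j)"
proof -
  obtain \<alpha> \<beta> where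
    \<alpha>: "\<And>k z. k \<le> n \<Longrightarrow> hom_monomial n k z = (\<Sum>i\<le>n. \<alpha> k i * B n i z)" and
    \<beta>: "\<And>i z. i \<le> n \<Longrightarrow> B n i z = (\<Sum>k\<le>n. \<beta> i k * hom_monomial n k z)"
    using change_of_basis[of n] by blast
  have "D n u i j = (\<Sum>k\<le>n. \<Sum>l\<le>n. \<beta> j k * hom_coeff k (n - k) l u * \<alpha> l i)" if u: "u \<in> SU2" for u
  proof -
    define E where "E i = (\<Sum>k\<le>n. \<Sum>l\<le>n. \<beta> j k * hom_coeff k (n - k) l u * \<alpha> l i)" for i
    have "(\<Sum>i\<le>n. (D n u i j - E i) * B n i z) = 0" for z
    proof -
      have "(\<Sum>i\<le>n. D n u i j * B n i z) = (\<Sum>k\<le>n. \<beta> j k * hom_monomial n k (z v* u))"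
        using assms u by (simp add: \<beta>[symmetric] act_sum)
      also have "\<dots> = (\<Sum>k\<le>n. \<Sum>l\<le>n. \<Sum>i\<le>n. \<beta> j k * hom_coeff k (n - k) l u * \<alpha> l i * B n i z)"
        by (intro sum.cong refl) (simp add: hom_monomial_act_le \<alpha> sum_distrib_left mult.assoc)
      also have "\<dots> = (\<Sum>k\<le>n. \<Sum>i\<le>n. \<Sum>l\<le>n. \<beta> j k * hom_coeff k (n - k) l u * \<alpha> l i * B n i z)"
        by (intro sum.cong refl sum.swap)
      also have "\<dots> = (\<Sum>i\<le>n. E i * B n i z)"
        by (subst sum.swap) (simp add: E_def sum_distrib_right)
      finally show ?thesis by (simp add: left_diff_distrib sum_subtractf)
    qed
    from B_independent[OF this assms(1)] show ?thesis by (simp add: E_def)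
  qed
  then have "continuous_on SU2 (\<lambda>u. D n u i j) \<longleftrightarrow>
      continuous_on SU2 (\<lambda>u. \<Sum>k\<le>n. \<Sum>l\<le>n. \<beta> j k * hom_coeff k (n - k) l u * \<alpha> l i)"
    by (intro continuous_on_cong refl)
  then show ?thesis by (auto intro!: continuous_intros hom_coeff_continuous)
qed

lemma B_act_continuous:
  assumes "j \<le> n"
  shows "continuous_on SU2 (\<lambda>u. B n j (z v* u))"
  using B_hom[OF assms]
  by (rule hom_polys_continuous) (auto simp: vector_matrix_mult_def intro!: continuous_intros)

section \<open>Invariant kernels and Schur orthogonality\<close>

lemma kernel_eq_0:
  assumes zero: "\<And>z w. (\<Sum>i\<le>n. \<Sum>k\<le>m. A i k * B n i z * cnj (B m k w)) = 0" and "i \<le> n" "k \<le> m"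
  shows "A i k = 0"
proof -
  have "(\<Sum>i\<le>n. (\<Sum>k\<le>m. A i k * cnj (B m k w)) * B n i z) = 0" for z w
    using zero[of z w] by (simp add: sum_distrib_left sum_distrib_right mult_ac)
  then have "(\<Sum>k\<le>m. A i k * cnj (B m k w)) = 0" for w
    using B_independent[where i = i and n = n and c = "\<lambda>i. \<Sum>k\<le>m. A i k * cnj (B m k w)"] assms(2) by blast
  \<comment> \<open>Conjugation turns the relation in \<open>w\<close> into a linear relation among
    the \<open>B m k\<close>.\<close>
  then have "cnj (\<Sum>k\<le>m. A i k * cnj (B m k w)) = 0" for w by simp
  then have "(\<Sum>k\<le>m. cnj (A i k) * B m k w) = 0" for w by (simp add: cnj_sum)
  then have "cnj (A i k) = 0"
    using B_independent[where i = k and n = m and c = "\<lambda>k. cnj (A i k)"] assms(3) by blast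
  then show ?thesis by simp
qed

lemma invariant_kernel_form:
  assumes inv: "\<And>z w v. v \<in> SU2 \<Longrightarrow>
      (\<Sum>i\<le>n. \<Sum>k\<le>m. A i k * B n i (z v* v) * cnj (B m k (w v* v))) = (\<Sum>i\<le>n. \<Sum>k\<le>m. A i k * B n i z * cnj (B m k w))"
    and "n \<le> m"
  shows "\<exists>c. (n < m \<longrightarrow> c = 0) \<and>
    (\<forall>z w. (\<Sum>i\<le>n. \<Sum>k\<le>m. A i k * B n i z * cnj (B m k w)) = c * (z $ 1 * cnj (w $ 1) + z $ 2 * cnj (w $ 2)) ^ n)"
proof (rule SU2_invariant_kernel[where K = "\<lambda>z w. \<Sum>i\<le>n. \<Sum>k\<le>m. A i k * B n i z * cnj (B m k w)" and m = m and n = n])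
  show "(\<lambda>z. \<Sum>i\<le>n. \<Sum>k\<le>m. A i k * B n i z * cnj (B m k w)) \<in> hom_polys n" for w
  proof -
    have "(\<Sum>i\<le>n. \<Sum>k\<le>m. A i k * B n i z * cnj (B m k w)) = (\<Sum>i\<le>n. (\<Sum>k\<le>m. A i k * cnj (B m k w)) * B n i z)" for z
      by (simp add: sum_distrib_left sum_distrib_right mult_ac)
    then show ?thesis by (simp only:) (intro hom_polys_sum B_hom, simp)
  qed
  show "(\<Sum>i\<le>n. \<Sum>k\<le>m. A i k * B n i z * cnj (B m k (c *s w)))
      = cnj c ^ m * (\<Sum>i\<le>n. \<Sum>k\<le>m. A i k * B n i z * cnj (B m k w))" for z w c
    unfolding sum_distrib_left
    by (intro sum.cong refl) (simp add: hom_polys_scale[OF B_hom])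
qed (fact inv \<open>n \<le> m\<close>)+

text \<open>By orthonormality of the rows of \<open>t n u\<close>, the kernel of the identity matrix
  is invariant. It supplies the nonzero kernel with which other invariant kernels are
  compared.\<close>

lemma kernel_inner:
  assumes "u \<in> SU2"
  shows "(\<Sum>i\<le>n. B n i (z v* u) * cnj (B n i (w v* u))) = (\<Sum>i\<le>n. B n i z * cnj (B n i w))"
proof -
  have "(\<Sum>i\<le>n. B n i (z v* u) * cnj (B n i (w v* u)))
      = (\<Sum>i\<le>n. \<Sum>p\<le>n. \<Sum>q\<le>n. D n u p i * cnj (D n u q i) * (B n p z * cnj (B n q w)))"
    using assms by (intro sum.cong refl) (simp add: act_sum cnj_sum sum_product mult_ac)
  also have "\<dots> = (\<Sum>p\<le>n. \<Sum>q\<le>n. \<Sum>i\<le>n. D n u p i * cnj (D n u q i) * (B n p z * cnj (B n q w)))"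
    by (subst sum.swap) (intro sum.cong refl sum.swap)
  also have "\<dots> = (\<Sum>p\<le>n. \<Sum>q\<le>n. of_bool (p = q) * (B n p z * cnj (B n q w)))"
    by (intro sum.cong refl) (simp add: D_unitary(1)[OF assms] flip: sum_distrib_right)
  also have "\<dots> = (\<Sum>p\<le>n. B n p z * cnj (B n p w))"
    by (intro sum.cong refl) simp
  finally show ?thesis .
qed

text \<open>This plays the part of Schur's lemma. For \<open>n = m\<close> the kernels of
  \<open>A\<close> and of the identity matrix are multiples of the same power, so \<open>A\<close>
  is scalar; for \<open>n < m\<close> the kernel vanishes.\<close>

lemma invariant_kernel_scalar:
  assumes inv: "\<And>z w v. v \<in> SU2 \<Longrightarrow>
      (\<Sum>i\<le>n. \<Sum>k\<le>m. A i k * B n i (z v* v) * cnj (B m k (w v* v))) = (\<Sum>i\<le>n. \<Sum>k\<le>m. A i k * B n i z * cnj (B m k w))"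
    and "n \<le> m"
  shows "\<exists>c. (n < m \<longrightarrow> c = 0) \<and> (\<forall>i\<le>n. \<forall>k\<le>m. A i k = (if i = k then c else 0))"
proof -
  obtain c where c: "n < m \<Longrightarrow> c = 0" and
    A: "\<And>z w. (\<Sum>i\<le>n. \<Sum>k\<le>m. A i k * B n i z * cnj (B m k w)) = c * (z $ 1 * cnj (w $ 1) + z $ 2 * cnj (w $ 2)) ^ n"
    using invariant_kernel_form[OF assms] by blast
  show ?thesis
  proof (cases "n < m")
    case True
    then show ?thesis using kernel_eq_0[where n = n and m = m and A = A] A c by (intro exI[of _ 0]) simp
  next
    case False
    then have "m = n" using \<open>n \<le> m\<close> by simp
    have diag: "(\<Sum>i\<le>n. \<Sum>k\<le>n. of_bool (i = k) * B n i z * cnj (B n k w)) = (\<Sum>i\<le>n. B n i z * cnj (B n i w))" for z w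
      by (intro sum.cong refl) (simp add: mult.assoc)
    have "\<exists>d. (n < n \<longrightarrow> d = 0) \<and> (\<forall>z w. (\<Sum>i\<le>n. \<Sum>k\<le>n. of_bool (i = k) * B n i z * cnj (B n k w))
        = d * (z $ 1 * cnj (w $ 1) + z $ 2 * cnj (w $ 2)) ^ n)"
      by (rule invariant_kernel_form[where A = "\<lambda>i k. of_bool (i = k)"]) (simp_all only: diag kernel_inner order_refl)
    then obtain d where I: "\<And>z w. (\<Sum>i\<le>n. \<Sum>k\<le>n. of_bool (i = k) * B n i z * cnj (B n k w))
        = d * (z $ 1 * cnj (w $ 1) + z $ 2 * cnj (w $ 2)) ^ n" by blast
    have "d \<noteq> 0"
    proof
      assume "d = 0"
      then have "(of_bool ((0 :: nat) = 0) :: complex) = 0"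
        using I by (intro kernel_eq_0[where n = n and m = n and A = "\<lambda>i k. of_bool (i = k)"]) auto
      then show False by simp
    qed
    have "A i k - c / d * of_bool (i = k) = 0" if "i \<le> n" "k \<le> n" for i k
    proof (rule kernel_eq_0[where A = "\<lambda>i k. A i k - c / d * of_bool (i = k)", OF _ that])
      fix z w
      have "(\<Sum>i\<le>n. \<Sum>k\<le>n. (A i k - c / d * of_bool (i = k)) * B n i z * cnj (B n k w))
        = (\<Sum>i\<le>n. \<Sum>k\<le>n. A i k * B n i z * cnj (B n k w))
          - c / d * (\<Sum>i\<le>n. \<Sum>k\<le>n. of_bool (i = k) * B n i z * cnj (B n k w))"
        unfolding sum_distrib_left sum_subtractf[symmetric] by (intro sum.cong refl) (simp only: left_diff_distrib mult.assoc)
      also have "\<dots> = 0" using A[unfolded \<open>m = n\<close>] \<open>d \<noteq> 0\<close> by (simp only: I) simp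
      finally show "(\<Sum>i\<le>n. \<Sum>k\<le>n. (A i k - c / d * of_bool (i = k)) * B n i z * cnj (B n k w)) = 0" .
    qed
    then show ?thesis using \<open>m = n\<close> by (intro exI[of _ "c / d"]) auto
  qed
qed

lemma integrable_D_mult:
  "i \<le> n \<Longrightarrow> j \<le> n \<Longrightarrow> k \<le> m \<Longrightarrow> l \<le> m \<Longrightarrow> integrable \<mu> (\<lambda>u. D n u i j * cnj (D m u k l))"
  by (intro integrable_continuous_on_SU2 continuous_intros D_continuous)

text \<open>For fixed columns \<open>j\<close> and \<open>l\<close>, the integrals are the
  coefficients of the average over \<open>u\<close> of
  \<open>B n j (z v* u) * cnj (B m l (w v* u))\<close>; left invariance of the measure makes this
  kernel invariant.\<close>

lemma schur_scalar:
  assumes "n \<le> m" "j \<le> n" "l \<le> m"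
  shows "\<exists>c. (n < m \<longrightarrow> c = 0) \<and>
    (\<forall>i\<le>n. \<forall>k\<le>m. (LINT u|\<mu>. D n u i j * cnj (D m u k l)) = (if i = k then c else 0))"
proof (rule invariant_kernel_scalar[where A = "\<lambda>i k. LINT u|\<mu>. D n u i j * cnj (D m u k l)", OF _ \<open>n \<le> m\<close>])
  have K: "(\<Sum>i\<le>n. \<Sum>k\<le>m. (LINT u|\<mu>. D n u i j * cnj (D m u k l)) * B n i z * cnj (B m k w))
      = (LINT u|\<mu>. B n j (z v* u) * cnj (B m l (w v* u)))" for z w
  proof -
    have "(LINT u|\<mu>. B n j (z v* u) * cnj (B m l (w v* u)))
        = (LINT u|\<mu>. (\<Sum>i\<le>n. \<Sum>k\<le>m. D n u i j * cnj (D m u k l) * (B n i z * cnj (B m k w))))"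
      using assms by (intro Bochner_Integration.integral_cong refl)
        (simp add: space_mu act_sum cnj_sum sum_product mult_ac)
    also have "\<dots> = (\<Sum>i\<le>n. LINT u|\<mu>. (\<Sum>k\<le>m. D n u i j * cnj (D m u k l) * (B n i z * cnj (B m k w))))"
      using assms by (intro Bochner_Integration.integral_sum Bochner_Integration.integrable_sum integrable_mult_left integrable_D_mult) auto
    also have "\<dots> = (\<Sum>i\<le>n. \<Sum>k\<le>m. LINT u|\<mu>. D n u i j * cnj (D m u k l) * (B n i z * cnj (B m k w)))"
      using assms by (intro sum.cong refl Bochner_Integration.integral_sum integrable_mult_left integrable_D_mult) auto
    finally show ?thesis by (simp only: Bochner_Integration.integral_mult_left_zero) (simp only: mult.assoc)
  qed
  fix z w v assume v: "v \<in> SU2"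
  have "continuous_on SU2 (\<lambda>u. B n j (z v* u) * cnj (B m l (w v* u)))"
    using assms by (intro continuous_intros B_act_continuous)
  from integral_left_invariant[OF v this]
  show "(\<Sum>i\<le>n. \<Sum>k\<le>m. (LINT u|\<mu>. D n u i j * cnj (D m u k l)) * B n i (z v* v) * cnj (B m k (w v* v)))
      = (\<Sum>i\<le>n. \<Sum>k\<le>m. (LINT u|\<mu>. D n u i j * cnj (D m u k l)) * B n i z * cnj (B m k w))"
    unfolding K by (simp add: vector_matrix_mul_assoc)
qed

lemma schur_orthogonality:
  assumes "i \<le> n" "j \<le> n" "k \<le> m" "l \<le> m"
  shows "(LINT u|\<mu>. D n u i j * cnj (D m u k l)) = (if n = m \<and> i = k \<and> j = l then 1 / of_nat (n + 1) else 0)"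
proof (cases n m rule: linorder_cases)
  case less
  then show ?thesis using schur_scalar[of n m j l] assms by fastforce
next
  case greater
  \<comment> \<open>The case \<open>n > m\<close> is the conjugate of the case with the two
    representations exchanged.\<close>
  have "(LINT u|\<mu>. D m u k l * cnj (D n u i j)) = 0"
    using schur_scalar[of m n l j] assms greater by fastforce
  then have "cnj (LINT u|\<mu>. D m u k l * cnj (D n u i j)) = 0" by simp
  then have "(LINT u|\<mu>. D n u i j * cnj (D m u k l)) = 0"
    unfolding Bochner_Integration.integral_cnj[symmetric] by (simp add: mult.commute)
  then show ?thesis using greater by simp
next
  case equal
  obtain c where c: "\<And>i k. i \<le> n \<Longrightarrow> k \<le> n \<Longrightarrow> (LINT u|\<mu>. D n u i j * cnj (D n u k l)) = (if i = k then c else 0)"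
    using schur_scalar[of n n j l] assms equal by blast
  \<comment> \<open>Summing over equal row indices determines \<open>c\<close>, because the columns
    are orthonormal.\<close>
  have "of_nat (n + 1) * c = (\<Sum>i\<le>n. LINT u|\<mu>. D n u i j * cnj (D n u i l))"
    using c by simp
  also have "\<dots> = (LINT u|\<mu>. (\<Sum>i\<le>n. D n u i j * cnj (D n u i l)))"
    using assms equal by (intro Bochner_Integration.integral_sum[symmetric] integrable_D_mult) auto
  also have "\<dots> = (LINT u|\<mu>. of_bool (l = j))"
    using assms equal by (intro Bochner_Integration.integral_cong refl)
      (simp add: space_mu D_unitary(2)[symmetric] mult.commute)
  also have "\<dots> = of_bool (l = j)" by (simp add: prob_space)
  finally have "c = of_bool (l = j) / of_nat (n + 1)"
    by (subst eq_divide_eq) (simp add: mult.commute del: of_nat_Suc of_nat_add)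
  then show ?thesis using c[of i k] assms equal by auto
qed

end

section \<open>Completeness of the matrix entries\<close>

context unitary_reps
begin

text \<open>A change of basis writes each generator as a combination of the entries
  \<open>D n u i j\<close>. Continuity is carried through the induction because additivity of the
  integral requires integrability of \<open>h u * cnj (g u)\<close>.\<close>

lemma matrix_coeff_span_orthogonal:
  assumes h: "integrable \<mu> h" and zero: "\<And>n i j. i \<le> n \<Longrightarrow> j \<le> n \<Longrightarrow> (LINT u|\<mu>. h u * cnj (D n u i j)) = 0"
    and g: "matrix_coeff_span g"
  shows "continuous_on SU2 g \<and> (LINT u|\<mu>. h u * cnj (g u)) = 0"
  using g
proof (induction g)
  case (coeff j k l)
  define n where "n = j + k"
  have "(LINT u|\<mu>. h u * cnj (hom_coeff j k l u)) = 0"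
  proof (cases "l \<le> n")
    case False
    then have "hom_coeff j k l u = 0" for u
      unfolding hom_coeff_def n_def
      using degree_linear_powers[of "u $ 2 $ 1" "u $ 1 $ 1" j "u $ 2 $ 2" "u $ 1 $ 2" k]
      by (intro coeff_eq_0) linarith
    then show ?thesis by simp
  next
    case True
    obtain \<alpha> \<beta> where
      \<alpha>: "\<And>k z. k \<le> n \<Longrightarrow> hom_monomial n k z = (\<Sum>i\<le>n. \<alpha> k i * B n i z)" and
      \<beta>: "\<And>i z. i \<le> n \<Longrightarrow> B n i z = (\<Sum>k\<le>n. \<beta> i k * hom_monomial n k z)"
      using change_of_basis[of n] by blast
    have eq: "hom_coeff j k l u = (\<Sum>p\<le>n. \<Sum>q\<le>n. \<alpha> j p * \<beta> q l * D n u q p)" if u: "u \<in> SU2" for u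
    proof -
      define E where "E l = (\<Sum>p\<le>n. \<Sum>q\<le>n. \<alpha> j p * \<beta> q l * D n u q p)" for l
      have "(\<Sum>l\<le>n. (hom_coeff j k l u - E l) * hom_monomial n l z) = 0" for z
      proof -
        have "(\<Sum>l\<le>n. hom_coeff j k l u * hom_monomial n l z) = (\<Sum>p\<le>n. \<alpha> j p * B n p (z v* u))"
          using hom_monomial_act[of j k z u] \<alpha>[of j "z v* u"] by (simp add: n_def)
        also have "\<dots> = (\<Sum>p\<le>n. \<Sum>q\<le>n. \<Sum>l\<le>n. \<alpha> j p * \<beta> q l * D n u q p * hom_monomial n l z)"
          using u by (intro sum.cong refl) (simp add: act_sum \<beta> sum_distrib_left mult_ac)
        also have "\<dots> = (\<Sum>p\<le>n. \<Sum>l\<le>n. \<Sum>q\<le>n. \<alpha> j p * \<beta> q l * D n u q p * hom_monomial n l z)"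
          by (intro sum.cong refl sum.swap)
        also have "\<dots> = (\<Sum>l\<le>n. E l * hom_monomial n l z)"
          by (subst sum.swap) (simp add: E_def sum_distrib_right)
        finally show ?thesis by (simp add: left_diff_distrib sum_subtractf)
      qed
      from hom_monomials_independent[OF this True] show ?thesis by (simp add: E_def)
    qed
    have int: "integrable \<mu> (\<lambda>u. h u * cnj (D n u q p))" if "q \<le> n" "p \<le> n" for p q
      using that by (intro integrable_mult_continuous_on_SU2[OF h] continuous_intros D_continuous)
    have "(LINT u|\<mu>. h u * cnj (hom_coeff j k l u))
        = (LINT u|\<mu>. (\<Sum>p\<le>n. \<Sum>q\<le>n. h u * cnj (D n u q p) * cnj (\<alpha> j p * \<beta> q l)))"
      by (intro Bochner_Integration.integral_cong refl)
        (simp add: space_mu eq cnj_sum sum_distrib_left mult_ac)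
    also have "\<dots> = (\<Sum>p\<le>n. LINT u|\<mu>. (\<Sum>q\<le>n. h u * cnj (D n u q p) * cnj (\<alpha> j p * \<beta> q l)))"
      by (intro Bochner_Integration.integral_sum Bochner_Integration.integrable_sum integrable_mult_left int) auto
    also have "\<dots> = (\<Sum>p\<le>n. \<Sum>q\<le>n. LINT u|\<mu>. h u * cnj (D n u q p) * cnj (\<alpha> j p * \<beta> q l))"
      by (intro sum.cong refl Bochner_Integration.integral_sum integrable_mult_left int) auto
    also have "\<dots> = 0"
      by (intro sum.neutral ballI) (simp only: Bochner_Integration.integral_mult_left_zero, simp add: zero)
    finally show ?thesis .
  qed
  then show ?case by (simp add: hom_coeff_continuous)
next
  case (add f g)
  have "integrable \<mu> (\<lambda>u. h u * cnj (f u))" "integrable \<mu> (\<lambda>u. h u * cnj (g u))"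
    using add.IH by (auto intro!: integrable_mult_continuous_on_SU2[OF h] continuous_intros)
  then show ?case
    using add.IH by (simp add: distrib_left continuous_on_add)
next
  case (scale f c)
  have "(LINT u|\<mu>. cnj c * (h u * cnj (f u))) = 0" using scale.IH by simp
  then show ?case
    using scale.IH by (simp add: continuous_on_mult mult.left_commute del: integral_mult_right_zero)
next
  case (cong f g)
  have "continuous_on SU2 g" using cong continuous_on_cong[of SU2 SU2 f g] by simp
  moreover have "(LINT u|\<mu>. h u * cnj (g u)) = (LINT u|\<mu>. h u * cnj (f u))"
    using cong.hyps by (intro Bochner_Integration.integral_cong refl) (simp add: space_mu)
  ultimately show ?case using cong.IH by simp
qed

text \<open>\<open>h\<close> is orthogonal to all real polynomials, which by Stone-Weierstrass are
  uniformly dense in the continuous real functions on the compact set \<open>SU2\<close>; continuous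
  functions in turn detect integrable ones.\<close>

lemma AE_eq_0_if_orthogonal:
  assumes h: "integrable \<mu> h" and zero: "\<And>n i j. i \<le> n \<Longrightarrow> j \<le> n \<Longrightarrow> (LINT u|\<mu>. h u * cnj (D n u i j)) = 0"
  shows "AE u in \<mu>. h u = 0"
proof (rule AE_eq_0_if_integral_continuous_eq_0[OF _ sets_mu SU2_borel h])
  show "finite_measure \<mu>" by unfold_locales
  fix c :: "complex^2^2 \<Rightarrow> real" assume "continuous_on UNIV c"
  then have c: "continuous_on SU2 c" by (rule continuous_on_subset) simp
  \<comment> \<open>\<open>hom_coeff 0 0 0\<close> is the constant \<open>1\<close>, so the
    polynomials themselves lie in the span.\<close>
  have poly: "(LINT u|\<mu>. h u * complex_of_real (q u)) = 0" "continuous_on SU2 (\<lambda>u. complex_of_real (q u))"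
    if "real_polynomial_function q" for q
    using matrix_coeff_span_orthogonal[OF h zero matrix_coeff_span_polynomial_mult[OF that matrix_coeff_span.coeff[of 0 0 0]]]
    by (simp_all add: hom_coeff_def)
  have "norm (LINT u|\<mu>. h u * complex_of_real (c u)) \<le> e * (LINT u|\<mu>. norm (h u))" if "e > 0" for e
  proof -
    obtain q where q: "real_polynomial_function q" "\<And>u. u \<in> SU2 \<Longrightarrow> \<bar>c u - q u\<bar> < e"
      using Stone_Weierstrass_real_polynomial_function[OF compact_SU2 c \<open>e > 0\<close>] by blast
    have int: "integrable \<mu> (\<lambda>u. h u * complex_of_real (c u))" "integrable \<mu> (\<lambda>u. h u * complex_of_real (q u))"
      using c poly(2)[OF q(1)] by (auto intro!: integrable_mult_continuous_on_SU2[OF h] continuous_intros)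
    have "(LINT u|\<mu>. h u * complex_of_real (c u))
        = (LINT u|\<mu>. h u * complex_of_real (c u) - h u * complex_of_real (q u))"
      using int poly(1)[OF q(1)] by simp
    also have "norm \<dots> \<le> (LINT u|\<mu>. norm (h u * complex_of_real (c u) - h u * complex_of_real (q u)))"
      by (rule integral_norm_bound)
    also have "\<dots> \<le> (LINT u|\<mu>. e * norm (h u))"
    proof (rule integral_mono)
      show "integrable \<mu> (\<lambda>u. norm (h u * complex_of_real (c u) - h u * complex_of_real (q u)))"
        using int by simp
      show "integrable \<mu> (\<lambda>u. e * norm (h u))" using h by simp
      fix u assume "u \<in> space \<mu>"
      then have "\<bar>c u - q u\<bar> \<le> e" using q(2)[of u] by (simp add: space_mu)
      have "norm (h u * complex_of_real (c u) - h u * complex_of_real (q u)) = norm (h u) * \<bar>c u - q u\<bar>"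
        by (simp add: norm_mult flip: right_diff_distrib of_real_diff)
      also have "\<dots> \<le> norm (h u) * e" using \<open>\<bar>c u - q u\<bar> \<le> e\<close> by (rule mult_left_mono) simp
      finally show "norm (h u * complex_of_real (c u) - h u * complex_of_real (q u)) \<le> e * norm (h u)"
        by (simp add: mult.commute)
    qed
    finally show ?thesis by simp
  qed
  moreover have "((\<lambda>e. e * (LINT u|\<mu>. norm (h u))) \<longlongrightarrow> 0 * (LINT u|\<mu>. norm (h u))) (at_right 0)"
    by (intro tendsto_intros)
  ultimately have "norm (LINT u|\<mu>. h u * complex_of_real (c u)) \<le> 0"
    by (intro tendsto_lowerbound[where F = "at_right (0 :: real)"]) (auto simp: eventually_at_right_less eventually_at_filter)
  then show "(LINT u|\<mu>. h u * complex_of_real (c u)) = 0" by simp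
qed

section \<open>Fourier blocks and the estimate for integrable functions\<close>

context
  fixes C :: "nat \<Rightarrow> nat \<Rightarrow> nat \<Rightarrow> complex"
begin

text \<open>The transposed indices make the double sum the trace of the product of
  \<open>C n\<close> and \<open>t n u\<close>.\<close>

definition block :: "nat \<Rightarrow> complex^2^2 \<Rightarrow> complex" where
  "block n u = of_nat (n + 1) * (\<Sum>i\<le>n. \<Sum>j\<le>n. C n i j * D n u j i)"

definition coeff_norm :: "nat \<Rightarrow> real" where
  "coeff_norm n = sqrt (\<Sum>i\<le>n. \<Sum>j\<le>n. (norm (C n i j))\<^sup>2)"

lemma block_continuous: "continuous_on SU2 (block n)"
  unfolding block_def by (intro continuous_intros D_continuous) auto

lemma coeff_norm_nonneg: "0 \<le> coeff_norm n"
  unfolding coeff_norm_def by (intro real_sqrt_ge_zero sum_nonneg) auto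

text \<open>Cauchy-Schwarz for the Hilbert-Schmidt product; a unitary matrix of size
  \<open>n + 1\<close> has Hilbert-Schmidt norm \<open>sqrt (n + 1)\<close>, so the exponent is
  \<open>1 + 1 / 2\<close>.\<close>

lemma block_bound:
  assumes u: "u \<in> SU2"
  shows "norm (block n u) \<le> (real n + 1) powr (3 / 2) * coeff_norm n"
proof -
  let ?I = "{..n} \<times> {..n}"
  have "norm (\<Sum>i\<le>n. \<Sum>j\<le>n. C n i j * D n u j i) = norm (\<Sum>x\<in>?I. C n (fst x) (snd x) * D n u (snd x) (fst x))"
    by (simp add: sum.cartesian_product case_prod_unfold)
  also have "\<dots> \<le> (\<Sum>x\<in>?I. \<bar>norm (C n (fst x) (snd x))\<bar> * \<bar>norm (D n u (snd x) (fst x))\<bar>)"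
    by (intro sum_norm_le) (simp add: norm_mult)
  also have "\<dots> \<le> L2_set (\<lambda>x. norm (C n (fst x) (snd x))) ?I * L2_set (\<lambda>x. norm (D n u (snd x) (fst x))) ?I"
    by (rule L2_set_mult_ineq)
  also have "L2_set (\<lambda>x. norm (C n (fst x) (snd x))) ?I = coeff_norm n"
    by (simp add: L2_set_def coeff_norm_def sum.cartesian_product case_prod_unfold)
  also have "L2_set (\<lambda>x. norm (D n u (snd x) (fst x))) ?I = sqrt (\<Sum>i\<le>n. \<Sum>j\<le>n. (norm (D n u j i))\<^sup>2)"
    by (simp add: L2_set_def sum.cartesian_product case_prod_unfold)
  also have "(\<Sum>i\<le>n. \<Sum>j\<le>n. (norm (D n u j i))\<^sup>2) = real n + 1"
  proof -
    have "complex_of_real (\<Sum>j\<le>n. (norm (D n u j i))\<^sup>2) = 1" if "i \<le> n" for i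
      using D_unitary(2)[OF u that that] by (simp add: complex_norm_square mult.commute del: of_real_power)
    then have "(\<Sum>j\<le>n. (norm (D n u j i))\<^sup>2) = 1" if "i \<le> n" for i
      using that by (simp only: of_real_eq_1_iff)
    then show ?thesis by simp
  qed
  finally have le: "norm (\<Sum>i\<le>n. \<Sum>j\<le>n. C n i j * D n u j i) \<le> coeff_norm n * sqrt (real n + 1)" .
  have "norm (block n u) = (real n + 1) * norm (\<Sum>i\<le>n. \<Sum>j\<le>n. C n i j * D n u j i)"
    unfolding block_def norm_mult norm_of_nat by simp
  also have "\<dots> \<le> (real n + 1) * (coeff_norm n * sqrt (real n + 1))"
    using le by (rule mult_left_mono) simp
  also have "(real n + 1) * (coeff_norm n * sqrt (real n + 1)) = (real n + 1) powr (1 + 1 / 2) * coeff_norm n"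
    by (simp only: powr_add) (simp add: powr_half_sqrt)
  finally show ?thesis by simp
qed

text \<open>The factor \<open>n + 1\<close> in \<open>block\<close> cancels the denominator in Schur
  orthogonality, so a block reproduces the coefficients defining it.\<close>

lemma integral_block_D:
  assumes "k \<le> m" "l \<le> m"
  shows "(LINT u|\<mu>. block n u * cnj (D m u k l)) = (if n = m then C n l k else 0)"
proof -
  have "(LINT u|\<mu>. block n u * cnj (D m u k l))
      = (LINT u|\<mu>. (\<Sum>i\<le>n. \<Sum>j\<le>n. (of_nat (n + 1) * C n i j) * (D n u j i * cnj (D m u k l))))"
    by (intro Bochner_Integration.integral_cong refl)
      (simp add: block_def sum_distrib_left sum_distrib_right mult_ac del: of_nat_Suc of_nat_add)
  also have "\<dots> = (\<Sum>i\<le>n. LINT u|\<mu>. (\<Sum>j\<le>n. (of_nat (n + 1) * C n i j) * (D n u j i * cnj (D m u k l))))"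
    using assms by (intro Bochner_Integration.integral_sum Bochner_Integration.integrable_sum integrable_mult_right integrable_D_mult) auto
  also have "\<dots> = (\<Sum>i\<le>n. \<Sum>j\<le>n. LINT u|\<mu>. (of_nat (n + 1) * C n i j) * (D n u j i * cnj (D m u k l)))"
    using assms by (intro sum.cong refl Bochner_Integration.integral_sum integrable_mult_right integrable_D_mult) auto
  also have "\<dots> = (\<Sum>i\<le>n. \<Sum>j\<le>n. of_nat (n + 1) * C n i j * (LINT u|\<mu>. D n u j i * cnj (D m u k l)))"
    by (simp only: Bochner_Integration.integral_mult_right_zero)
  also have "\<dots> = (\<Sum>i\<le>n. \<Sum>j\<le>n. if j = k then (if n = m \<and> i = l then C n i j else 0) else 0)"
    using assms by (intro sum.cong refl) (auto simp: schur_orthogonality simp del: of_nat_Suc of_nat_add)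
  also have "\<dots> = (\<Sum>i\<le>n. if i = l then (if n = m then C n l k else 0) else 0)"
    using assms by (intro sum.cong refl) (auto simp: sum.delta)
  also have "\<dots> = (if n = m then C n l k else 0)"
    using assms by (auto simp: sum.delta)
  finally show ?thesis .
qed

lemma integral_block_block:
  "(LINT u|\<mu>. block n u * cnj (block m u))
    = (if n = m then complex_of_real ((real n + 1) * (coeff_norm n)\<^sup>2) else 0)"
proof -
  have int: "integrable \<mu> (\<lambda>u. block n u * cnj (D m u j i))" if "i \<le> m" "j \<le> m" for i j
    using that by (intro integrable_continuous_on_SU2 continuous_intros D_continuous block_continuous)
  have "(LINT u|\<mu>. block n u * cnj (block m u))
      = (LINT u|\<mu>. (\<Sum>i\<le>m. \<Sum>j\<le>m. (of_nat (m + 1) * cnj (C m i j)) * (block n u * cnj (D m u j i))))"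
    by (intro Bochner_Integration.integral_cong refl, subst (2) block_def)
      (simp add: cnj_sum sum_distrib_left sum_distrib_right mult_ac del: of_nat_Suc of_nat_add)
  also have "\<dots> = (\<Sum>i\<le>m. LINT u|\<mu>. (\<Sum>j\<le>m. (of_nat (m + 1) * cnj (C m i j)) * (block n u * cnj (D m u j i))))"
    by (intro Bochner_Integration.integral_sum Bochner_Integration.integrable_sum integrable_mult_right int) auto
  also have "\<dots> = (\<Sum>i\<le>m. \<Sum>j\<le>m. LINT u|\<mu>. (of_nat (m + 1) * cnj (C m i j)) * (block n u * cnj (D m u j i)))"
    by (intro sum.cong refl Bochner_Integration.integral_sum integrable_mult_right int) auto
  also have "\<dots> = (\<Sum>i\<le>m. \<Sum>j\<le>m. of_nat (m + 1) * cnj (C m i j) * (LINT u|\<mu>. block n u * cnj (D m u j i)))"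
    by (simp only: Bochner_Integration.integral_mult_right_zero)
  also have "\<dots> = (\<Sum>i\<le>m. \<Sum>j\<le>m. if n = m then of_nat (n + 1) * complex_of_real ((norm (C n i j))\<^sup>2) else 0)"
    by (intro sum.cong refl) (auto simp: integral_block_D complex_norm_square mult_ac simp del: of_nat_Suc of_nat_add of_real_power)
  also have "\<dots> = (if n = m then complex_of_real ((real n + 1) * (\<Sum>i\<le>n. \<Sum>j\<le>n. (norm (C n i j))\<^sup>2)) else 0)"
    by (simp add: sum_distrib_left add.commute)
  also have "(\<Sum>i\<le>n. \<Sum>j\<le>n. (norm (C n i j))\<^sup>2) = (coeff_norm n)\<^sup>2"
    unfolding coeff_norm_def by (intro real_sqrt_pow2[symmetric] sum_nonneg) auto
  finally show ?thesis .
qed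

text \<open>The partial sums of the blocks have a limit \<open>g\<close> with the same Fourier
  coefficients as \<open>f\<close>. By completeness \<open>f\<close> and \<open>g\<close> agree
  almost everywhere, so the bound for \<open>g\<close> transfers to \<open>f\<close>.\<close>

lemma hardy_littlewood:
  assumes f: "integrable \<mu> f" and C: "\<And>n i j. i \<le> n \<Longrightarrow> j \<le> n \<Longrightarrow> C n i j = (LINT u|\<mu>. f u * cnj (D n u j i))"
    and p: "2 \<le> p" and sm: "summable (\<lambda>n. (real n + 1) powr (5 / 2 * p - 4) * coeff_norm n powr p)"
  shows "integrable \<mu> (\<lambda>u. norm (f u) powr p)"
    and "(LINT u|\<mu>. norm (f u) powr p) \<le> 4 * 2 powr (p - 2) * (1 + (4 * p) powr p)
      * (\<Sum>n. (real n + 1) powr (5 / 2 * p - 4) * coeff_norm n powr p)"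
proof -
  \<comment> \<open>The sup bound from \<open>block_bound\<close>; its exponent \<open>3 / 2\<close>
    turns the weight exponent \<open>p - 4\<close> into \<open>5 / 2 * p - 4\<close>.\<close>
  define b where "b n = (real n + 1) powr (3 / 2) * coeff_norm n" for n
  have b0: "0 \<le> b n" for n using coeff_norm_nonneg by (simp add: b_def)
  have b_powr: "(real n + 1) powr (p - 4) * b n powr p = (real n + 1) powr (5 / 2 * p - 4) * coeff_norm n powr p" for n
  proof -
    have "(real n + 1) powr (p - 4) * b n powr p = ((real n + 1) powr (p - 4) * (real n + 1) powr (3 / 2 * p)) * coeff_norm n powr p"
      by (simp add: b_def powr_mult powr_powr coeff_norm_nonneg)
    also have "(real n + 1) powr (p - 4) * (real n + 1) powr (3 / 2 * p) = (real n + 1) powr (5 / 2 * p - 4)"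
      unfolding powr_add[symmetric] by (simp add: field_simps)
    finally show ?thesis .
  qed
  have sm': "summable (\<lambda>n. (real n + 1) powr (p - 4) * b n powr p)" unfolding b_powr by (rule sm)
  have b_sq: "(b n / (real n + 1))\<^sup>2 = (real n + 1) * (coeff_norm n)\<^sup>2" for n
  proof -
    have "((real n + 1) powr (3 / 2))\<^sup>2 = (real n + 1) ^ 3"
      by (simp add: power2_eq_square powr_numeral flip: powr_add)
    then have "(b n / (real n + 1))\<^sup>2 = (real n + 1) ^ 3 * (coeff_norm n)\<^sup>2 / (real n + 1)\<^sup>2"
      unfolding b_def power_divide power_mult_distrib by (rule arg_cong)
    also have "\<dots> = (real n + 1) * (coeff_norm n)\<^sup>2"
      by (simp add: eval_nat_numeral)
    finally show ?thesis .
  qed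
  interpret orthogonal_blocks \<mu> block b
  proof
    show "block n \<in> borel_measurable \<mu>" for n
      by (rule measurable_continuous_on_SU2[OF block_continuous])
    show "norm (block n u) \<le> b n" if "u \<in> space \<mu>" for n u
      using that block_bound by (simp add: b_def space_mu)
    show "(LINT u|\<mu>. block n u * cnj (block m u)) = 0" if "n \<noteq> m" for n m
      using that by (simp add: integral_block_block)
    show "(LINT u|\<mu>. block n u * cnj (block n u)) = complex_of_real ((b n / (real n + 1))\<^sup>2)" for n
      by (simp only: integral_block_block b_sq if_True refl)
    show "summable (\<lambda>n. (b n / (real n + 1))\<^sup>2)"
      by (rule summable_square_of_weighted[OF b0 p sm'])
  qed
  obtain g r where gr: "g \<in> borel_measurable \<mu>" "strict_mono r" "AE u in \<mu>. (\<lambda>i. L (r i) u) \<longlonglongrightarrow> g u"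
    by (rule AE_convergent_subseq)
  note int_g = limit_integrable[OF gr]
  have cont: "continuous_on SU2 (\<lambda>u. cnj (D n u i j))" if "i \<le> n" "j \<le> n" for n i j
    using that by (intro continuous_intros D_continuous)
  have "AE u in \<mu>. f u - g u = 0"
  proof (rule AE_eq_0_if_orthogonal)
    show "integrable \<mu> (\<lambda>u. f u - g u)" using f int_g by simp
    fix n i j :: nat assume ij: "i \<le> n" "j \<le> n"
    obtain K where K: "\<And>u. u \<in> SU2 \<Longrightarrow> norm (cnj (D n u i j)) \<le> K"
      using continuous_on_SU2_bounded[OF cont[OF ij]] by blast
    have lim_g: "(\<lambda>N. LINT u|\<mu>. L N u * cnj (D n u i j)) \<longlonglongrightarrow> (LINT u|\<mu>. g u * cnj (D n u i j))"
      using measurable_continuous_on_SU2[OF cont[OF ij]] K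
      by (intro integral_limit[OF gr]) (auto simp: space_mu)
    \<comment> \<open>By orthogonality only the block with index \<open>n\<close> contributes, and
      it is present as soon as \<open>N > n\<close>.\<close>
    have "\<forall>\<^sub>F N in sequentially. (LINT u|\<mu>. L N u * cnj (D n u i j)) = C n j i"
    proof (rule eventually_sequentiallyI[of "Suc n"])
      fix N assume "Suc n \<le> N"
      have "(LINT u|\<mu>. L N u * cnj (D n u i j)) = (LINT u|\<mu>. (\<Sum>m<N. block m u * cnj (D n u i j)))"
        by (simp add: L_def sum_distrib_right)
      also have "\<dots> = (\<Sum>m<N. LINT u|\<mu>. block m u * cnj (D n u i j))"
        using ij by (intro Bochner_Integration.integral_sum integrable_continuous_on_SU2 continuous_intros block_continuous D_continuous)
      also have "\<dots> = C n j i"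
        using ij \<open>Suc n \<le> N\<close> by (simp add: integral_block_D)
      finally show "(LINT u|\<mu>. L N u * cnj (D n u i j)) = C n j i" .
    qed
    then have lim_C: "(\<lambda>N. LINT u|\<mu>. L N u * cnj (D n u i j)) \<longlonglongrightarrow> C n j i" by (rule tendsto_eventually)
    have "(LINT u|\<mu>. g u * cnj (D n u i j)) = (LINT u|\<mu>. f u * cnj (D n u i j))"
      using LIMSEQ_unique[OF lim_g lim_C] C[OF ij(2,1)] by simp
    moreover have "integrable \<mu> (\<lambda>u. f u * cnj (D n u i j))" "integrable \<mu> (\<lambda>u. g u * cnj (D n u i j))"
      using integrable_mult_continuous_on_SU2[OF _ cont[OF ij]] f int_g by auto
    ultimately show "(LINT u|\<mu>. (f u - g u) * cnj (D n u i j)) = 0"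
      by (simp add: left_diff_distrib)
  qed
  then have fg: "AE u in \<mu>. norm (f u) powr p = norm (g u) powr p" by eventually_elim simp
  have meas: "(\<lambda>u. norm (f u) powr p) \<in> borel_measurable \<mu>" "(\<lambda>u. norm (g u) powr p) \<in> borel_measurable \<mu>"
    using f int_g by auto
  show "integrable \<mu> (\<lambda>u. norm (f u) powr p)"
    using limit_Lp(1)[OF gr p sm'] integrable_cong_AE[OF meas fg] by simp
  show "(LINT u|\<mu>. norm (f u) powr p) \<le> 4 * 2 powr (p - 2) * (1 + (4 * p) powr p)
      * (\<Sum>n. (real n + 1) powr (5 / 2 * p - 4) * coeff_norm n powr p)"
    using limit_Lp(2)[OF gr p sm'] integral_cong_AE[OF meas fg] by (simp only: b_powr)
qed

end

end

section \<open>Hilbert-Schmidt norms and conclusion\<close>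

lemma hs_norm_eq:
  assumes "A \<in> carrier_mat (n + 1) (n + 1)"
  shows "hs_norm A = sqrt (\<Sum>i\<le>n. \<Sum>j\<le>n. (norm (A $$ (i, j)))\<^sup>2)"
proof -
  note c' = mat_adjoint_carrier[OF assms]
  have "mat_trace (A * mat_adjoint A) = (\<Sum>i\<le>n. (A * mat_adjoint A) $$ (i, i))"
    using assms unfolding mat_trace_def sum_lessThan_add_1[symmetric] by simp
  also have "\<dots> = (\<Sum>i\<le>n. \<Sum>j\<le>n. A $$ (i, j) * cnj (A $$ (i, j)))"
    by (intro sum.cong refl) (simp add: index_mult_mat_sum[OF assms c'] mat_adjoint_index[OF assms])
  also have "\<dots> = complex_of_real (\<Sum>i\<le>n. \<Sum>j\<le>n. (norm (A $$ (i, j)))\<^sup>2)"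
    by (simp add: complex_norm_square del: of_real_power)
  finally show ?thesis by (simp add: hs_norm_def)
qed

theorem corollary2p3:
  fixes p :: real
  assumes "2 \<le> p"
  shows "\<exists>c::real. c > 0 \<and> (\<forall>(\<mu> :: (complex^2^2) measure) (t :: nat \<Rightarrow> complex^2^2 \<Rightarrow> complex mat)
           (f :: complex^2^2 \<Rightarrow> complex).
           normalized_haar_SU2 \<mu> \<longrightarrow> (\<forall>n. unitary_rep_SU2 n (t n)) \<longrightarrow>
           f \<in> Lp_space \<mu> 1 \<longrightarrow>
           summable (\<lambda>n. (real n + 1) powr (5/2 * p - 4) * hs_norm (fourier_coeff \<mu> t f n) powr p) \<longrightarrow>
             f \<in> Lp_space \<mu> p \<and>
             Lp_norm \<mu> p f powr p
               \<le> c * (\<Sum>n. (real n + 1) powr (5/2 * p - 4) * hs_norm (fourier_coeff \<mu> t f n) powr p))"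
\<comment> \<open>The witness is the constant of \<open>limit_Lp\<close>:
  \<open>4 * 2 powr (p - 2)\<close> comes from the layers with their doubled levels,
  \<open>1 + (4 * p) powr p\<close> from the weighted inequalities. It is fixed before the measure,
  the representations and \<open>f\<close>.\<close>
proof (intro exI[of _ "4 * 2 powr (p - 2) * (1 + (4 * p) powr p)"] conjI[of "_ > _"] allI impI)
  show "4 * 2 powr (p - 2) * (1 + (4 * p) powr p) > 0"
    by (intro mult_pos_pos add_pos_nonneg) auto
  fix \<mu> :: "(complex^2^2) measure" and t :: "nat \<Rightarrow> complex^2^2 \<Rightarrow> complex mat" and f :: "complex^2^2 \<Rightarrow> complex"
  assume haar: "normalized_haar_SU2 \<mu>" and rep: "\<forall>n. unitary_rep_SU2 n (t n)" and f1: "f \<in> Lp_space \<mu> 1"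
    and sm: "summable (\<lambda>n. (real n + 1) powr (5/2 * p - 4) * hs_norm (fourier_coeff \<mu> t f n) powr p)"
  from choice[OF rep[unfolded unitary_rep_SU2_def]]
  obtain B where B: "\<forall>n. is_basis_hom_polys n (B n) \<and> (\<forall>u\<in>SU2. unitary_mat (n + 1) (t n u) \<and>
      (\<forall>j<n + 1. \<forall>z. SU2_act u (B n j) z = (\<Sum>i<n + 1. t n u $$ (i, j) * B n i z)))" ..
  interpret unitary_reps \<mu> t B
    using haar B by unfold_locales (simp_all del: sum.lessThan_Suc)
  have f: "f \<in> borel_measurable \<mu>" "integrable \<mu> f"
    using f1 by (auto simp: Lp_space_def intro: Bochner_Integration.integrable_norm_cancel)
  define C where "C n i j = fourier_coeff \<mu> t f n $$ (i, j)" for n i j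
  \<comment> \<open>The adjoint in \<open>fourier_coeff\<close> interchanges the indices, matching
    the transposed indices of \<open>block\<close>.\<close>
  have C: "C n i j = (LINT u|\<mu>. f u * cnj (D n u j i))" if "i \<le> n" "j \<le> n" for n i j
  proof -
    have "C n i j = (LINT u|\<mu>. f u * mat_adjoint (t n u) $$ (i, j))"
      using that by (simp add: C_def fourier_coeff_def)
    also have "\<dots> = (LINT u|\<mu>. f u * cnj (D n u j i))"
    proof (intro Bochner_Integration.integral_cong refl)
      fix u assume "u \<in> space \<mu>"
      then have "t n u \<in> carrier_mat (n + 1) (n + 1)"
        using unitary[of u n] by (simp add: space_mu unitary_mat_def)
      from mat_adjoint_index[OF this] show "f u * mat_adjoint (t n u) $$ (i, j) = f u * cnj (D n u j i)"
        using that by (simp add: D_def)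
    qed
    finally show ?thesis .
  qed
  have hs: "hs_norm (fourier_coeff \<mu> t f n) = coeff_norm C n" for n
    unfolding coeff_norm_def C_def by (rule hs_norm_eq) (simp add: fourier_coeff_def)
  note bound = hardy_littlewood[OF f(2) C assms sm[unfolded hs]]
  have "f \<in> Lp_space \<mu> p" using f(1) bound(1) by (simp add: Lp_space_def)
  moreover have "Lp_norm \<mu> p f powr p = (LINT u|\<mu>. norm (f u) powr p)"
    using assms by (simp add: Lp_norm_def powr_powr)
  ultimately show "f \<in> Lp_space \<mu> p \<and> Lp_norm \<mu> p f powr p \<le> 4 * 2 powr (p - 2) * (1 + (4 * p) powr p)
      * (\<Sum>n. (real n + 1) powr (5/2 * p - 4) * hs_norm (fourier_coeff \<mu> t f n) powr p)"
    using bound(2) by (simp only: hs)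
qed

end
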